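(* Let $N\ge 2$, let $\Omega\subset\mathbb{R}^N$ be a Lipschitz bounded domain, and let $0<s<1<p<\frac{N}{s}$. Let $\phi_p^s$ be the $(s,p)$-torsion function of $\Omega$, $\lambda_{1,p}^s(\Omega)$ the first eigenvalue of the fractional $p$-Laplacian, and $e_p^s$ the positive, $L^\infty$-normalized first eigenfunction. Then $$e_p^s\le\lambda_{1,p}^s(\Omega)^{\frac{1}{p-1}}\,\phi_p^s\quad\text{a.e. in }\Omega$$ and $$\frac{1}{|\phi_p^s|_\infty^{p-1}}\le\lambda_{1,p}^s(\Omega)\le\frac{|\Omega|^{p-1}}{|\phi_p^s|_1^{p-1}} .$$
   Context: $|\cdot|_r$ denotes the usual norm of $L^r(\Omega)$, $1\le r\le\infty$, and $|\Omega|$ is the Lebesgue measure of $\Omega$. For a measurable function $u:\mathbb{R}^N\to\mathbb{R}$, $[u]_{s,p}:=\left(\int_{\mathbb{R}^N}\int_{\mathbb{R}^N}\frac{|u(x)-u(y)|^p}{|x-y|^{N+sp}}\,dx\,dy\right)^{1/p}$. The space $W_0^{s,p}(\Omega)$ is the closure of $C_0^\infty(\Omega)$ with respect to the norm $\|u\|:=[u]_{s,p}+|u|_p$; its elements are regarded as functions on $\mathbb{R}^N$ vanishing in $\mathbb{R}^N\setminus\Omega$. For $u,\varphi\in W_0^{s,p}(\Omega)$ put $$\langle(-\Delta)_p^s u,\varphi\rangle:=\int_{\mathbb{R}^N}\int_{\mathbb{R}^N}\frac{|u(x)-u(y)|^{p-2}(u(x)-u(y))(\varphi(x)-\varphi(y))}{|x-y|^{N+sp}}\,dx\,dy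 .$$ The $(s,p)$-torsion function $\phi_p^s$ of $\Omega$ is the unique function in $W_0^{s,p}(\Omega)$ with $\langle(-\Delta)_p^s\phi_p^s,\varphi\rangle=\int_\Omega\varphi\,dx$ for all $\varphi\in W_0^{s,p}(\Omega)$; it is nonnegative. The first eigenvalue is the least $\lambda$ for which $(-\Delta)_p^s u=\lambda|u|^{p-2}u$ in $\Omega$, $u=0$ in $\mathbb{R}^N\setminus\Omega$, has a nontrivial weak solution; it is characterized by $\lambda_{1,p}^s(\Omega)=\min\{[u]_{s,p}^p: u\in W_0^{s,p}(\Omega),\ |u|_p=1\}$. It is known that first eigenfunctions belong to $L^\infty(\Omega)$, are either positive a.e. or negative a.e. in $\Omega$, and are scalar multiples of each other. $e_p^s$ denotes the positive one with $|e_p^s|_\infty=1$; thus $e_p^s\in W_0^{s,p}(\Omega)$ and $\langle(-\Delta)_p^s e_p^s,\varphi\rangle=\lambda_{1,p}^s(\Omega)\int_\Omega(e_p^s)^{p-1}\varphi\,dx$ for all $\varphi\in W_0^{s,p}(\Omega)$. *)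

theory Defs
  imports "HOL-Analysis.Analysis" "HOL-Probability.Essential_Supremum"
begin

(* The boundary is locally a Lipschitz graph, stated without a rotation of coordinates: near x0 the set
   lies strictly above the graph of \<gamma> over the hyperplane orthogonal to the unit vector d. *)
definition lipschitz_boundary :: "'a::euclidean_space set \<Rightarrow> bool" where
  "lipschitz_boundary \<Omega> \<longleftrightarrow>
     (\<forall>x0\<in>frontier \<Omega>. \<exists>r>0. \<exists>d. \<exists>\<gamma> :: 'a \<Rightarrow> real. \<exists>L.
        norm d = 1 \<and> L-lipschitz_on {z. z \<bullet> d = 0} \<gamma> \<and>
        (\<forall>y\<in>ball x0 r. y \<in> \<Omega> \<longleftrightarrow> \<gamma> (y - (y \<bullet> d) *\<^sub>R d) < y \<bullet> d))"

definition lipschitz_bounded_domain :: "'a::euclidean_space set \<Rightarrow> bool" where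
  "lipschitz_bounded_domain \<Omega> \<longleftrightarrow>
     open \<Omega> \<and> connected \<Omega> \<and> \<Omega> \<noteq> {} \<and> bounded \<Omega> \<and> lipschitz_boundary \<Omega>"

primrec C_k :: "nat \<Rightarrow> ('a::euclidean_space \<Rightarrow> real) \<Rightarrow> bool" where
  "C_k 0 f \<longleftrightarrow> continuous_on UNIV f"
| "C_k (Suc k) f \<longleftrightarrow>
     (\<forall>x. f differentiable at x) \<and> (\<forall>v. C_k k (\<lambda>x. frechet_derivative f (at x) v))"

definition test_function :: "'a::euclidean_space set \<Rightarrow> ('a \<Rightarrow> real) \<Rightarrow> bool" where
  "test_function \<Omega> f \<longleftrightarrow>
     (\<forall>k. C_k k f) \<and> compact (closure {x. f x \<noteq> 0}) \<and> closure {x. f x \<noteq> 0} \<subseteq> \<Omega>"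

(* Only used for exponents r > 0, where infinity to the power r is infinity. *)
definition epowr :: "ennreal \<Rightarrow> real \<Rightarrow> ennreal" where
  "epowr x r = (if x = top then top else ennreal (enn2real x powr r))"

definition Lnorm :: "real \<Rightarrow> 'a::euclidean_space set \<Rightarrow> ('a \<Rightarrow> real) \<Rightarrow> ennreal" where
  "Lnorm r \<Omega> u = epowr (\<integral>\<^sup>+x. ennreal (\<bar>u x\<bar> powr r) \<partial>lebesgue_on \<Omega>) (1 / r)"

definition Linf_norm :: "'a::euclidean_space set \<Rightarrow> ('a \<Rightarrow> real) \<Rightarrow> ennreal" where
  "Linf_norm \<Omega> u = esssup (lebesgue_on \<Omega>) (\<lambda>x. ennreal \<bar>u x\<bar>)"

(* On the diagonal x = y the integrands below are 0 / 0 = 0; the diagonal is a null set. *)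
definition gagliardo :: "real \<Rightarrow> real \<Rightarrow> ('a::euclidean_space \<Rightarrow> real) \<Rightarrow> ennreal" where
  "gagliardo s p u = epowr
     (\<integral>\<^sup>+(x, y). ennreal (\<bar>u x - u y\<bar> powr p / norm (x - y) powr (real DIM('a) + s * p))
        \<partial>(lebesgue \<Otimes>\<^sub>M lebesgue)) (1 / p)"

(* The space W_0^{s,p}(\<Omega>), as a set of representatives closed under equality almost everywhere.
   A function in the closure has finite norm, because test functions do. *)
definition W0 :: "real \<Rightarrow> real \<Rightarrow> 'a::euclidean_space set \<Rightarrow> ('a \<Rightarrow> real) set" where
  "W0 s p \<Omega> =
     {u. u \<in> borel_measurable lebesgue \<and> (AE x in lebesgue. x \<notin> \<Omega> \<longrightarrow> u x = 0) \<and>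
         (\<forall>\<epsilon>>0. \<exists>f. test_function \<Omega> f \<and>
            gagliardo s p (\<lambda>x. u x - f x) + Lnorm p \<Omega> (\<lambda>x. u x - f x) < \<epsilon>)}"

(* The pairing of (-\<Delta>)_p^s u with v. For u, v in W_0^{s,p}(\<Omega>) the integrand is integrable
   by Hoelder's inequality; where u x = u y it is 0 also for p < 2. *)
definition frac_plap :: "real \<Rightarrow> real \<Rightarrow> ('a::euclidean_space \<Rightarrow> real) \<Rightarrow> ('a \<Rightarrow> real) \<Rightarrow> real" where
  "frac_plap s p u v =
     (\<integral>(x, y). \<bar>u x - u y\<bar> powr (p - 2) * (u x - u y) * (v x - v y)
                / norm (x - y) powr (real DIM('a) + s * p) \<partial>(lebesgue \<Otimes>\<^sub>M lebesgue))"

definition torsion_function ::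
    "real \<Rightarrow> real \<Rightarrow> 'a::euclidean_space set \<Rightarrow> ('a \<Rightarrow> real) \<Rightarrow> bool" where
  "torsion_function s p \<Omega> \<phi> \<longleftrightarrow>
     \<phi> \<in> W0 s p \<Omega> \<and> (\<forall>v\<in>W0 s p \<Omega>. frac_plap s p \<phi> v = (\<integral>x. v x \<partial>lebesgue_on \<Omega>))"

definition eigenfunction ::
    "real \<Rightarrow> real \<Rightarrow> 'a::euclidean_space set \<Rightarrow> real \<Rightarrow> ('a \<Rightarrow> real) \<Rightarrow> bool" where
  "eigenfunction s p \<Omega> \<mu> u \<longleftrightarrow>
     u \<in> W0 s p \<Omega> \<and> \<not> (AE x in lebesgue. u x = 0) \<and>
     (\<forall>v\<in>W0 s p \<Omega>.
        frac_plap s p u v = \<mu> * (\<integral>x. \<bar>u x\<bar> powr (p - 2) * u x * v x \<partial>lebesgue_on \<Omega>))"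

definition first_eigenvalue :: "real \<Rightarrow> real \<Rightarrow> 'a::euclidean_space set \<Rightarrow> real" where
  "first_eigenvalue s p \<Omega> = (LEAST \<mu>. \<exists>u. eigenfunction s p \<Omega> \<mu> u)"

definition normalized_first_eigenfunction ::
    "real \<Rightarrow> real \<Rightarrow> 'a::euclidean_space set \<Rightarrow> ('a \<Rightarrow> real) \<Rightarrow> bool" where
  "normalized_first_eigenfunction s p \<Omega> e \<longleftrightarrow>
     eigenfunction s p \<Omega> (first_eigenvalue s p \<Omega>) e \<and>
     (AE x in lebesgue_on \<Omega>. e x > 0) \<and> Linf_norm \<Omega> e = 1"

end

theory Submission
  imports Defs
begin

text \<open>
  Write J(t) = |t|^(p-2) t, let \<mu> be the first eigenvalue and e the positive normalized
  eigenfunction. Three observations give the result.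

  \<^item> Since 0 < e \<le> 1, the function e satisfies an equation with right-hand side \<mu> e^(p-1) \<le> \<mu>,
    and \<mu> is the right-hand side of the equation satisfied by \<mu>^(1/(p-1)) \<phi>. The weak comparison
    principle (comparison_principle), which is the monotonicity of J tested with the positive part
    of the difference, gives e \<le> \<mu>^(1/(p-1)) \<phi> (eigenfunction_le_torsion_function).

  \<^item> Taking essential suprema there yields 1 \<le> \<mu>^(1/(p-1)) |\<phi>|_\<infinity>, the lower bound for \<mu>.

  \<^item> Picone's inequality, tested with |f|^p / (e + \<epsilon>)^(p-1), shows that an eigenvalue
    with a positive eigenfunction is at most every Rayleigh quotient (rayleigh_quotient_bound).
    No minimizer has to be constructed. The quotient of \<phi> itself is at most |\<phi>|_1 / |\<phi>|_p^p, because
    the energy of \<phi> equals the integral of \<phi>, and Jensen's inequality turns this into the upper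
    bound (eigenvalue_le_of_torsion_function).

  Both test functions, the positive part of a difference and the quotient in Picone's
  inequality, have to be shown to lie in W0, the closure of the smooth functions with compact
  support. The point is that each is a limit of smooth Lipschitz expressions in two elements of W0; such an
  expression turns test functions into test functions, and a dominated convergence theorem with
  dominating functions that converge in the p-th mean (lp_dominated_convergence) shows that the
  results converge in the norm of W0 (W0_of_dominated_limit). It relies on the finite energy of
  test functions (energy_test_function_finite).

  The singular kernel is absorbed into a measure on pairs of points (gagliardo_measure), so that
  the Gagliardo seminorm is an ordinary p-th mean of the difference function.
\<close>

section \<open>Smooth functions and test functions\<close>

text \<open>
  Any explicit formula for the derivative certifies smoothness, so that the chosen derivative
  frechet_derivative need not be computed.
\<close>

lemma C_k_SucI:
  assumes "\<And>x. (f has_derivative f' x) (at x)" and "\<And>v. C_k k (\<lambda>x. f' x v)"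
  shows "C_k (Suc k) f"
proof -
  have "frechet_derivative f (at x) = f' x" for x
    using frechet_derivative_at[OF assms(1)] by simp
  then show ?thesis
    using assms by (auto simp: differentiable_def)
qed

lemma C_k_SucD:
  assumes "C_k (Suc k) f"
  shows "(f has_derivative frechet_derivative f (at x)) (at x)"
    and "C_k k (\<lambda>x. frechet_derivative f (at x) v)"
  using assms frechet_derivative_works by auto

lemma C_k_lower: "C_k (Suc k) f \<Longrightarrow> C_k k f"
proof (induction k arbitrary: f)
  case 0
  then show ?case
    by (auto intro!: continuous_at_imp_continuous_on differentiable_imp_continuous_within)
next
  case (Suc k)
  show ?case
    by (rule C_k_SucI[OF C_k_SucD(1)[OF Suc.prems] Suc.IH[OF C_k_SucD(2)[OF Suc.prems]]])
qed

lemma C_k_const: "C_k k (\<lambda>x. c)"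
  by (induction k arbitrary: c) (auto simp: frechet_derivative_const)

lemma C_k_add: "C_k k f \<Longrightarrow> C_k k g \<Longrightarrow> C_k k (\<lambda>x. f x + g x)"
proof (induction k arbitrary: f g)
  case 0
  then show ?case by (auto intro: continuous_intros)
next
  case (Suc k)
  show ?case
    by (rule C_k_SucI[OF has_derivative_add[OF C_k_SucD(1)[OF Suc.prems(1)] C_k_SucD(1)[OF Suc.prems(2)]]
          Suc.IH[OF C_k_SucD(2)[OF Suc.prems(1)] C_k_SucD(2)[OF Suc.prems(2)]]])
qed

lemma C_k_mult: "C_k k f \<Longrightarrow> C_k k g \<Longrightarrow> C_k k (\<lambda>x. f x * g x)"
proof (induction k arbitrary: f g)
  case 0
  then show ?case by (auto intro: continuous_intros)
next
  case (Suc k)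
  note f = Suc.prems(1) and g = Suc.prems(2)
  show ?case
    by (rule C_k_SucI[OF has_derivative_mult[OF C_k_SucD(1)[OF f] C_k_SucD(1)[OF g]]])
       (intro C_k_add Suc.IH C_k_lower[OF f] C_k_lower[OF g] C_k_SucD(2)[OF f] C_k_SucD(2)[OF g])
qed

lemma C_k_diff: "C_k k f \<Longrightarrow> C_k k g \<Longrightarrow> C_k k (\<lambda>x. f x - g x)"
  using C_k_add[OF _ C_k_mult[OF C_k_const[of k "- 1"]], of f g] by simp

text \<open>
  The induction runs over all exponents at once, because differentiation lowers the exponent
  by one. Square roots and negative powers of positive functions are included.
\<close>

lemma C_k_powr:
  assumes "\<And>x. f x > 0"
  shows "C_k k f \<Longrightarrow> C_k k (\<lambda>x. f x powr a)"
proof (induction k arbitrary: a)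
  case 0
  then show ?case
    using assms by (auto intro!: continuous_intros simp: order.strict_implies_not_eq[OF assms] less_imp_neq[symmetric])
next
  case (Suc k)
  have "((\<lambda>x. f x powr a) has_derivative
      (\<lambda>v. frechet_derivative f (at x) v * (a * f x powr (a - 1)))) (at x)" for x
    using has_real_derivative_powr[OF assms[of x], of a] C_k_SucD(1)[OF Suc.prems, of x]
    by (rule DERIV_compose_FDERIV)
  then show ?case
    by (rule C_k_SucI) (intro C_k_mult C_k_const Suc.IH C_k_lower[OF Suc.prems] C_k_SucD(2)[OF Suc.prems])
qed

text \<open>
  The support of h lies in the union of the supports of f and g. Hence nonlinear combinations
  of test functions are test functions as soon as they are smooth and vanish at the origin.
\<close>

lemma test_function_combine:
  assumes "test_function \<Omega> f" and "test_function \<Omega> g" and "\<And>k. C_k k h"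
    and "\<And>x. f x = 0 \<Longrightarrow> g x = 0 \<Longrightarrow> h x = 0"
  shows "test_function \<Omega> h"
proof -
  have sub: "closure {x. h x \<noteq> 0} \<subseteq> closure {x. f x \<noteq> 0} \<union> closure {x. g x \<noteq> 0}"
    unfolding closure_Un[symmetric] using assms(4) by (intro closure_mono) auto
  have "compact (closure {x. f x \<noteq> 0} \<union> closure {x. g x \<noteq> 0})"
    using assms(1,2) by (auto simp: test_function_def)
  then have "compact (closure {x. h x \<noteq> 0})"
    using sub by (metis closed_closure compact_Int_closed inf.absorb_iff2)
  then show ?thesis
    using sub assms(1,2,3) by (auto simp: test_function_def)
qed

lemma test_function_continuous: "test_function \<Omega> f \<Longrightarrow> continuous_on UNIV f"
  unfolding test_function_def using C_k.simps(1) by blast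

lemma compactly_supported_continuous_bounded:
  fixes f :: "'a::euclidean_space \<Rightarrow> real"
  assumes "continuous_on UNIV f" and "compact K" and "\<And>x. x \<notin> K \<Longrightarrow> f x = 0"
  obtains M where "M > 0" "\<And>x. \<bar>f x\<bar> \<le> M"
proof -
  have "bounded (f ` K)"
    using assms compact_continuous_image compact_imp_bounded continuous_on_subset subset_UNIV by metis
  then obtain M where "M > 0" "\<forall>y\<in>f ` K. norm y \<le> M"
    using bounded_pos by blast
  then have "\<bar>f x\<bar> \<le> M" for x
    using assms(3)[of x] by (cases "x \<in> K") auto
  with \<open>M > 0\<close> show ?thesis using that by blast
qed

lemma test_function_bounded:
  assumes "test_function \<Omega> f"
  obtains M where "M > 0" "\<And>x. \<bar>f x\<bar> \<le> M"
proof (rule compactly_supported_continuous_bounded[of f "closure {x. f x \<noteq> 0}"])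
  show "f x = 0" if "x \<notin> closure {x. f x \<noteq> 0}" for x
    using that closure_subset[of "{x. f x \<noteq> 0}"] by blast
qed (use assms test_function_continuous that in \<open>auto simp: test_function_def\<close>)

text \<open>
  Each directional derivative is continuous and vanishes off the support, hence is bounded; the
  bounds for the basis directions add up to a bound for the operator norm of the derivative.
\<close>

lemma test_function_lipschitz:
  assumes "test_function \<Omega> f"
  obtains L where "L > 0" "\<And>x y. \<bar>f x - f y\<bar> \<le> L * norm (x - y)"
proof -
  let ?K = "closure {x. f x \<noteq> 0}"
  let ?D = "\<lambda>x. frechet_derivative f (at x)"
  have C1: "C_k (Suc 0) f" and K: "compact ?K"
    using assms by (auto simp only: test_function_def)
  have zero: "?D x v = 0" if "x \<notin> ?K" for x v
  proof -
    have "\<forall>\<^sub>F y in at x. f y = 0"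
      using that closure_subset[of "{x. f x \<noteq> 0}"]
      by (intro eventually_at_topological[THEN iffD2] exI[of _ "- ?K"]) auto
    moreover have "f x = 0"
      using that closure_subset[of "{x. f x \<noteq> 0}"] by blast
    ultimately have "(f has_derivative (\<lambda>_. 0)) (at x)"
      by (intro has_derivative_transform_eventually[OF has_derivative_const[of 0]])
        (auto elim: eventually_mono)
    then show ?thesis
      using frechet_derivative_at by metis
  qed
  have "\<forall>b. \<exists>M>0. \<forall>x. \<bar>?D x b\<bar> \<le> M"
  proof
    fix b
    have "continuous_on UNIV (\<lambda>x. ?D x b)" using C1 by simp
    from compactly_supported_continuous_bounded[OF this K zero]
    show "\<exists>M>0. \<forall>x. \<bar>?D x b\<bar> \<le> M" by metis
  qed
  then obtain M where M: "\<And>b. M b > 0" "\<And>b x. \<bar>?D x b\<bar> \<le> M b" by metis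
  let ?L = "\<Sum>b\<in>Basis. M b"
  have deriv: "(f has_derivative ?D x) (at x within UNIV)" for x
    using C_k_SucD(1)[OF C1] by simp
  have bound: "onorm (?D x) \<le> ?L" for x
  proof (rule onorm_le)
    fix v
    interpret bounded_linear "?D x" using deriv has_derivative_bounded_linear by blast
    have "?D x v = ?D x (\<Sum>b\<in>Basis. (v \<bullet> b) *\<^sub>R b)"
      by (simp add: euclidean_representation)
    also have "\<dots> = (\<Sum>b\<in>Basis. (v \<bullet> b) * ?D x b)"
      by (simp add: sum scaleR)
    finally have "norm (?D x v) \<le> (\<Sum>b\<in>Basis. \<bar>(v \<bullet> b) * ?D x b\<bar>)"
      by (simp add: sum_abs)
    also have "\<dots> \<le> (\<Sum>b\<in>Basis. norm v * M b)"
      unfolding abs_mult using M Basis_le_norm by (intro sum_mono mult_mono) auto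
    finally show "norm (?D x v) \<le> ?L * norm v"
      by (simp add: sum_distrib_left mult.commute)
  qed
  have "\<bar>f x - f y\<bar> \<le> ?L * norm (x - y)" for x y
    using differentiable_bound[OF convex_UNIV deriv bound, of x y] by simp
  moreover have "?L > 0" using M by (intro sum_pos) auto
  ultimately show ?thesis using that by blast
qed

section \<open>Inequalities for powers\<close>

lemma powr_add_le:
  fixes a b p :: real
  assumes "0 \<le> a" "0 \<le> b" "0 \<le> p"
  shows "(a + b) powr p \<le> 2 powr p * (a powr p + b powr p)"
proof -
  have "(a + b) powr p \<le> (2 * max a b) powr p"
    using assms by (intro powr_mono2) auto
  also have "\<dots> = 2 powr p * max a b powr p"
    by (simp add: powr_mult)
  also have "max a b powr p \<le> a powr p + b powr p"
    by (auto simp: max_def)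
  finally show ?thesis by simp
qed

text \<open>
  This is the convexity of the p-th power for a + b = (1 - \<theta>) (a / (1 - \<theta>)) + \<theta> (b / \<theta>). The
  first coefficient tends to 1 as \<theta> tends to 0, which makes the inequality a substitute for the
  continuity of the norm; the choice of \<theta> in picone_discrete turns it into Picone's inequality.
\<close>

lemma powr_add_le_weighted:
  fixes a b p \<theta> :: real
  assumes "0 \<le> a" "0 \<le> b" "1 \<le> p" "0 < \<theta>" "\<theta> < 1"
  shows "(a + b) powr p \<le> (1 - \<theta>) powr (1 - p) * a powr p + \<theta> powr (1 - p) * b powr p"
proof -
  have ge1: "1 \<le> t powr (1 - p)" if "0 < t" "t < 1" for t
    using that assms powr_mono'[of "1 - p" 0 t] by simp
  consider "a = 0" | "b = 0" | "a > 0" "b > 0"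
    using assms by fastforce
  then show ?thesis
  proof cases
    case 1
    then show ?thesis
      using mult_right_mono[OF ge1[of \<theta>], of "b powr p"] assms by simp
  next
    case 2
    then show ?thesis
      using mult_right_mono[OF ge1[of "1 - \<theta>"], of "a powr p"] assms by simp
  next
    case 3
    have conv: "convex_on {0<..} (\<lambda>x::real. x powr p)"
      by (rule powr_convex[OF assms(3)])
    have "((1 - \<theta>) *\<^sub>R (a / (1 - \<theta>)) + \<theta> *\<^sub>R (b / \<theta>)) powr p
        \<le> (1 - \<theta>) * (a / (1 - \<theta>)) powr p + \<theta> * (b / \<theta>) powr p"
      using 3 assms by (intro convex_onD[OF conv]) auto
    moreover have "t * (c / t) powr p = t powr (1 - p) * c powr p" if "0 < t" "0 < c" for t c :: real
      using that by (simp add: powr_divide powr_diff)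
    ultimately show ?thesis
      using 3 assms by simp
  qed
qed

text \<open>
  The nonlinearity of the p-Laplacian, that is, the derivative of |t|^p / p.
\<close>

definition signed_power :: "real \<Rightarrow> real \<Rightarrow> real" where
  "signed_power p t = \<bar>t\<bar> powr (p - 2) * t"

lemma signed_power_measurable [measurable]: "signed_power p \<in> borel_measurable borel"
  unfolding signed_power_def by measurable

lemma signed_power_uminus: "signed_power p (- t) = - signed_power p t"
  by (simp add: signed_power_def)

lemma signed_power_nonneg: "0 \<le> t \<Longrightarrow> signed_power p t = t powr (p - 1)"
  by (cases "t = 0") (simp_all add: signed_power_def powr_mult_base mult.commute)

lemma signed_power_self: "signed_power p t * t = \<bar>t\<bar> powr p"
proof -
  have "signed_power p t * t = \<bar>t\<bar> * (\<bar>t\<bar> * \<bar>t\<bar> powr (p - 2))"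
    by (simp add: signed_power_def algebra_simps)
  then show ?thesis
    by (simp add: powr_mult_base)
qed

lemma signed_power_scale: "0 \<le> c \<Longrightarrow> signed_power p (c * t) = c powr (p - 1) * signed_power p t"
  by (cases "c = 0") (simp_all add: signed_power_def abs_mult powr_mult powr_mult_base[symmetric] 
      algebra_simps powr_diff power2_eq_square)

lemma abs_signed_power: "\<bar>signed_power p t\<bar> = \<bar>t\<bar> powr (p - 1)"
  by (cases "t = 0") (simp_all add: signed_power_def abs_mult powr_mult_base mult.commute)

lemma signed_power_strict_mono:
  assumes "1 < p" "a < b"
  shows "signed_power p a < signed_power p b"
proof -
  have pos: "signed_power p a < signed_power p b" if "0 \<le> a" "a < b" for a b
    using that assms by (simp add: signed_power_nonneg powr_less_mono2)
  consider "0 \<le> a" | "b \<le> 0" | "a < 0" "0 < b" by linarith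
  then show ?thesis
  proof cases
    case 2
    then show ?thesis using pos[of "- b" "- a"] assms by (simp add: signed_power_uminus)
  next
    case 3
    then show ?thesis using pos[of 0 b] pos[of 0 "- a"] by (simp add: signed_power_uminus signed_power_nonneg[of 0])
  qed (use pos assms in auto)
qed

lemma signed_power_mult_le:
  assumes "1 < p"
  shows "\<bar>signed_power p a * b\<bar> \<le> \<bar>a\<bar> powr p + \<bar>b\<bar> powr p"
proof -
  let ?m = "max \<bar>a\<bar> \<bar>b\<bar>"
  have "\<bar>signed_power p a * b\<bar> \<le> ?m powr (p - 1) * ?m"
    unfolding abs_mult abs_signed_power using assms by (intro mult_mono powr_mono2) auto
  also have "\<dots> = ?m powr p"
    by (simp add: powr_mult_base mult.commute)
  also have "\<dots> \<le> \<bar>a\<bar> powr p + \<bar>b\<bar> powr p"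
    by (simp add: max_def)
  finally show ?thesis .
qed

text \<open>
  The left-hand side is invariant under exchanging the two points, as the nonlinearity is odd. So
  let \<beta> < \<alpha> and put \<theta> = (\<alpha> - \<beta>) / \<alpha>. The weighted convexity inequality for
  a \<le> b + |a - b|, multiplied by \<theta>^(p-1), is the claim.
\<close>

lemma picone_discrete:
  assumes p: "1 < p" and "0 < \<alpha>" "0 < \<beta>" and "0 \<le> a" "0 \<le> b"
  shows "signed_power p (\<alpha> - \<beta>) * (a powr p * \<alpha> powr (1 - p) - b powr p * \<beta> powr (1 - p))
    \<le> \<bar>a - b\<bar> powr p"
proof -
  have main: "signed_power p (\<alpha> - \<beta>) * (a powr p * \<alpha> powr (1 - p) - b powr p * \<beta> powr (1 - p))
    \<le> \<bar>a - b\<bar> powr p"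
    if "0 < \<beta>" "\<beta> < \<alpha>" "0 \<le> a" "0 \<le> b" for \<alpha> \<beta> a b
  proof -
    define \<theta> where "\<theta> = (\<alpha> - \<beta>) / \<alpha>"
    have \<theta>: "0 < \<theta>" "\<theta> < 1" "1 - \<theta> = \<beta> / \<alpha>"
      using that by (auto simp: \<theta>_def field_simps)
    have "a powr p \<le> (b + \<bar>a - b\<bar>) powr p"
      using that p by (intro powr_mono2) auto
    also have "\<dots> \<le> (\<beta> / \<alpha>) powr (1 - p) * b powr p + \<theta> powr (1 - p) * \<bar>a - b\<bar> powr p"
      using powr_add_le_weighted[of b "\<bar>a - b\<bar>" p \<theta>] \<theta> that p by simp
    finally have "\<theta> powr (p - 1) * a powr p
        \<le> \<theta> powr (p - 1) * ((\<beta> / \<alpha>) powr (1 - p) * b powr p + \<theta> powr (1 - p) * \<bar>a - b\<bar> powr p)"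
      by (intro mult_left_mono) auto
    also have "\<dots> = \<theta> powr (p - 1) * (\<beta> / \<alpha>) powr (1 - p) * b powr p + \<bar>a - b\<bar> powr p"
      using \<theta> by (simp add: distrib_left powr_add[symmetric] flip: mult.assoc)
    also have "\<theta> powr (p - 1) * (\<beta> / \<alpha>) powr (1 - p) = (\<alpha> - \<beta>) powr (p - 1) * \<beta> powr (1 - p)"
      using that by (simp add: \<theta>_def powr_divide powr_diff field_simps)
    finally have "\<theta> powr (p - 1) * a powr p
        \<le> (\<alpha> - \<beta>) powr (p - 1) * \<beta> powr (1 - p) * b powr p + \<bar>a - b\<bar> powr p" .
    moreover have "\<theta> powr (p - 1) = (\<alpha> - \<beta>) powr (p - 1) * \<alpha> powr (1 - p)"
      using that by (simp add: \<theta>_def powr_divide powr_diff field_simps)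
    ultimately show ?thesis
      using that by (simp add: signed_power_nonneg algebra_simps)
  qed
  consider "\<alpha> = \<beta>" | "\<beta> < \<alpha>" | "\<alpha> < \<beta>" by linarith
  then show ?thesis
  proof cases
    case 1
    then show ?thesis by (simp add: signed_power_def)
  next
    case 2
    then show ?thesis using main assms by simp
  next
    case 3
    then show ?thesis
      using main[of \<alpha> \<beta> b a] assms signed_power_uminus[of p "\<beta> - \<alpha>"]
      by (simp add: algebra_simps abs_minus_commute)
  qed
qed

section \<open>Convergence in the p-th mean\<close>

lemma ennreal_tendsto_0_le:
  fixes f g :: "nat \<Rightarrow> ennreal"
  assumes "g \<longlonglongrightarrow> 0" and "\<And>n. f n \<le> g n"
  shows "f \<longlonglongrightarrow> 0"
  by (rule tendsto_sandwich[OF _ _ tendsto_const assms(1)]) (simp_all add: assms(2))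

text \<open>
  The dominating functions depend on n, but their variable parts A n vanish in the p-th mean. What
  remains of the error |G0 - G n| after subtracting A n is at most 2 B and converges to 0 pointwise,
  so the ordinary dominated convergence theorem applies to it.
\<close>

lemma lp_dominated_convergence:
  fixes G :: "nat \<Rightarrow> 'a \<Rightarrow> real"
  assumes [measurable]: "\<And>n. G n \<in> borel_measurable M" "G0 \<in> borel_measurable M"
      "\<And>n. A n \<in> borel_measurable M" "B \<in> borel_measurable M"
    and p: "0 < p" and A: "\<And>n x. 0 \<le> A n x" and B: "\<And>x. 0 \<le> B x"
    and A0: "(\<lambda>n. \<integral>\<^sup>+x. ennreal (A n x powr p) \<partial>M) \<longlonglongrightarrow> 0"
    and Bfin: "(\<integral>\<^sup>+x. ennreal (B x powr p) \<partial>M) < \<infinity>"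
    and bound: "\<And>n. AE x in M. \<bar>G n x\<bar> \<le> A n x + B x"
    and bound0: "AE x in M. \<bar>G0 x\<bar> \<le> B x"
    and lim: "AE x in M. (\<lambda>n. G n x) \<longlonglongrightarrow> G0 x"
  shows "(\<lambda>n. \<integral>\<^sup>+x. ennreal (\<bar>G0 x - G n x\<bar> powr p) \<partial>M) \<longlonglongrightarrow> 0"
proof -
  define R where "R n x = max 0 (\<bar>G0 x - G n x\<bar> - A n x)" for n x
  have [measurable]: "R n \<in> borel_measurable M" for n
    unfolding R_def by measurable
  have "(\<lambda>n. \<integral>\<^sup>+x. ennreal (R n x powr p) \<partial>M) \<longlonglongrightarrow> (\<integral>\<^sup>+x. 0 \<partial>M)"
  proof (rule nn_integral_dominated_convergence[where w = "\<lambda>x. ennreal (2 powr p * (B x powr p))"])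
    show "AE x in M. ennreal (R n x powr p) \<le> ennreal (2 powr p * (B x powr p))" for n
      using bound[of n] bound0
    proof eventually_elim
      case (elim x)
      then have "R n x powr p \<le> (2 * B x) powr p"
        using p B[of x] by (intro powr_mono2) (auto simp: R_def)
      then show ?case using B[of x] by (simp add: powr_mult ennreal_leI)
    qed
    show "(\<integral>\<^sup>+x. ennreal (2 powr p * (B x powr p)) \<partial>M) < \<infinity>"
      using Bfin by (simp add: ennreal_mult nn_integral_cmult ennreal_mult_less_top)
    show "AE x in M. (\<lambda>n. ennreal (R n x powr p)) \<longlonglongrightarrow> 0"
      using lim
    proof eventually_elim
      case (elim x)
      have "(\<lambda>n. \<bar>G0 x - G n x\<bar>) \<longlonglongrightarrow> \<bar>G0 x - G0 x\<bar>"
        by (intro tendsto_intros elim)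
      then have "(\<lambda>n. R n x) \<longlonglongrightarrow> 0"
        by (intro Lim_null_comparison[of "\<lambda>n. R n x" "\<lambda>n. \<bar>G0 x - G n x\<bar>"])
           (use A in \<open>auto simp: R_def\<close>)
      then have "(\<lambda>n. R n x powr p) \<longlonglongrightarrow> 0 powr p"
        using p by (intro tendsto_powr') (auto simp: R_def)
      then show ?case using p by (intro tendsto_ennrealI[of _ 0, simplified]) simp
    qed
  qed auto
  then have lim': "(\<lambda>n. ennreal (2 powr p) * ((\<integral>\<^sup>+x. ennreal (R n x powr p) \<partial>M)
      + (\<integral>\<^sup>+x. ennreal (A n x powr p) \<partial>M))) \<longlonglongrightarrow> ennreal (2 powr p) * (0 + 0)"
    using A0 by (intro tendsto_intros ennreal_tendsto_cmult) auto
  show ?thesis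
  proof (rule ennreal_tendsto_0_le)
    show "(\<lambda>n. ennreal (2 powr p) * ((\<integral>\<^sup>+x. ennreal (R n x powr p) \<partial>M)
      + (\<integral>\<^sup>+x. ennreal (A n x powr p) \<partial>M))) \<longlonglongrightarrow> 0"
      using lim' by simp
    fix n
      have "(\<integral>\<^sup>+x. ennreal (\<bar>G0 x - G n x\<bar> powr p) \<partial>M)
          \<le> (\<integral>\<^sup>+x. ennreal (2 powr p) * (ennreal (R n x powr p) + ennreal (A n x powr p)) \<partial>M)"
      proof (rule nn_integral_mono)
        fix x
        have "\<bar>G0 x - G n x\<bar> powr p \<le> (R n x + A n x) powr p"
          using p by (intro powr_mono2) (auto simp: R_def)
        also have "\<dots> \<le> 2 powr p * (R n x powr p + A n x powr p)"
          using p A by (intro powr_add_le) (auto simp: R_def)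
        finally show "ennreal (\<bar>G0 x - G n x\<bar> powr p)
            \<le> ennreal (2 powr p) * (ennreal (R n x powr p) + ennreal (A n x powr p))"
          by (simp add: ennreal_leI flip: ennreal_mult ennreal_plus)
      qed
      also have "\<dots> = ennreal (2 powr p) * ((\<integral>\<^sup>+x. ennreal (R n x powr p) \<partial>M)
          + (\<integral>\<^sup>+x. ennreal (A n x powr p) \<partial>M))"
        by (simp add: nn_integral_cmult nn_integral_add)
      finally show "(\<integral>\<^sup>+x. ennreal (\<bar>G0 x - G n x\<bar> powr p) \<partial>M) \<le> \<dots>" .
  qed
qed

lemma lp_norm_finite_of_diff:
  fixes Fl F :: "'a \<Rightarrow> real"
  assumes [measurable]: "Fl \<in> borel_measurable M" "F \<in> borel_measurable M" and "0 \<le> p"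
    and "(\<integral>\<^sup>+x. ennreal (\<bar>Fl x - F x\<bar> powr p) \<partial>M) < \<infinity>" "(\<integral>\<^sup>+x. ennreal (\<bar>F x\<bar> powr p) \<partial>M) < \<infinity>"
  shows "(\<integral>\<^sup>+x. ennreal (\<bar>Fl x\<bar> powr p) \<partial>M) < \<infinity>"
proof -
  have "(\<integral>\<^sup>+x. ennreal (\<bar>Fl x\<bar> powr p) \<partial>M)
      \<le> (\<integral>\<^sup>+x. ennreal (2 powr p) * (ennreal (\<bar>Fl x - F x\<bar> powr p) + ennreal (\<bar>F x\<bar> powr p)) \<partial>M)"
  proof (rule nn_integral_mono)
    fix x
    have "\<bar>Fl x\<bar> powr p \<le> (\<bar>Fl x - F x\<bar> + \<bar>F x\<bar>) powr p"
      using assms by (intro powr_mono2) auto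
    also have "\<dots> \<le> 2 powr p * (\<bar>Fl x - F x\<bar> powr p + \<bar>F x\<bar> powr p)"
      using assms by (intro powr_add_le) auto
    finally show "ennreal (\<bar>Fl x\<bar> powr p)
        \<le> ennreal (2 powr p) * (ennreal (\<bar>Fl x - F x\<bar> powr p) + ennreal (\<bar>F x\<bar> powr p))"
      by (simp add: ennreal_leI flip: ennreal_mult ennreal_plus)
  qed
  also have "\<dots> = ennreal (2 powr p) * ((\<integral>\<^sup>+x. ennreal (\<bar>Fl x - F x\<bar> powr p) \<partial>M)
      + (\<integral>\<^sup>+x. ennreal (\<bar>F x\<bar> powr p) \<partial>M))"
    by (simp add: nn_integral_cmult nn_integral_add)
  also have "\<dots> < \<infinity>"
    using assms by (simp add: ennreal_mult_less_top)
  finally show ?thesis .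
qed

text \<open>
  Convergence in the p-th mean passes from F n and H n to G n through a pointwise linear bound. In
  the application all functions are difference functions on pairs of points, and G n is a
  Lipschitz expression in two approximating sequences.
\<close>

lemma lp_convergence_of_domination:
  fixes F G H :: "nat \<Rightarrow> 'a \<Rightarrow> real"
  assumes [measurable]: "\<And>n. F n \<in> borel_measurable M" "Fl \<in> borel_measurable M"
      "\<And>n. H n \<in> borel_measurable M" "Hl \<in> borel_measurable M"
      "\<And>n. G n \<in> borel_measurable M" "Gl \<in> borel_measurable M"
    and p: "0 < p" and C: "0 \<le> C"
    and F: "(\<lambda>n. \<integral>\<^sup>+x. ennreal (\<bar>Fl x - F n x\<bar> powr p) \<partial>M) \<longlonglongrightarrow> 0"
      "(\<integral>\<^sup>+x. ennreal (\<bar>Fl x\<bar> powr p) \<partial>M) < \<infinity>" "AE x in M. (\<lambda>n. F n x) \<longlonglongrightarrow> Fl x"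
    and H: "(\<lambda>n. \<integral>\<^sup>+x. ennreal (\<bar>Hl x - H n x\<bar> powr p) \<partial>M) \<longlonglongrightarrow> 0"
      "(\<integral>\<^sup>+x. ennreal (\<bar>Hl x\<bar> powr p) \<partial>M) < \<infinity>" "AE x in M. (\<lambda>n. H n x) \<longlonglongrightarrow> Hl x"
    and bound: "\<And>n x. \<bar>G n x\<bar> \<le> C * (\<bar>F n x\<bar> + \<bar>H n x\<bar>)"
    and G: "AE x in M. (\<lambda>n. G n x) \<longlonglongrightarrow> Gl x"
  shows "(\<lambda>n. \<integral>\<^sup>+x. ennreal (\<bar>Gl x - G n x\<bar> powr p) \<partial>M) \<longlonglongrightarrow> 0"
proof -
  have sum_le: "(\<integral>\<^sup>+x. ennreal ((C * (\<bar>a x\<bar> + \<bar>b x\<bar>)) powr p) \<partial>M)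
      \<le> ennreal (C powr p * 2 powr p)
        * ((\<integral>\<^sup>+x. ennreal (\<bar>a x\<bar> powr p) \<partial>M) + (\<integral>\<^sup>+x. ennreal (\<bar>b x\<bar> powr p) \<partial>M))"
    if [measurable]: "a \<in> borel_measurable M" "b \<in> borel_measurable M" for a b :: "'a \<Rightarrow> real"
  proof -
    have "(\<integral>\<^sup>+x. ennreal ((C * (\<bar>a x\<bar> + \<bar>b x\<bar>)) powr p) \<partial>M)
        \<le> (\<integral>\<^sup>+x. ennreal (C powr p * 2 powr p) * (ennreal (\<bar>a x\<bar> powr p) + ennreal (\<bar>b x\<bar> powr p)) \<partial>M)"
    proof (rule nn_integral_mono)
      fix x
      have "C powr p * (\<bar>a x\<bar> + \<bar>b x\<bar>) powr p \<le> C powr p * (2 powr p * (\<bar>a x\<bar> powr p + \<bar>b x\<bar> powr p))"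
        using p by (intro mult_left_mono powr_add_le) auto
      then show "ennreal ((C * (\<bar>a x\<bar> + \<bar>b x\<bar>)) powr p)
          \<le> ennreal (C powr p * 2 powr p) * (ennreal (\<bar>a x\<bar> powr p) + ennreal (\<bar>b x\<bar> powr p))"
        using C by (simp add: powr_mult mult.assoc ennreal_leI flip: ennreal_mult ennreal_plus)
    qed
    also have "\<dots> = ennreal (C powr p * 2 powr p)
        * ((\<integral>\<^sup>+x. ennreal (\<bar>a x\<bar> powr p) \<partial>M) + (\<integral>\<^sup>+x. ennreal (\<bar>b x\<bar> powr p) \<partial>M))"
      by (simp add: nn_integral_cmult nn_integral_add)
    finally show ?thesis .
  qed
  let ?A = "\<lambda>n x. C * (\<bar>Fl x - F n x\<bar> + \<bar>Hl x - H n x\<bar>)"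
  let ?B = "\<lambda>x. C * (\<bar>Fl x\<bar> + \<bar>Hl x\<bar>)"
  show ?thesis
  proof (rule lp_dominated_convergence[where A = ?A and B = ?B])
    have "(\<lambda>n. ennreal (C powr p * 2 powr p) * ((\<integral>\<^sup>+x. ennreal (\<bar>Fl x - F n x\<bar> powr p) \<partial>M)
        + (\<integral>\<^sup>+x. ennreal (\<bar>Hl x - H n x\<bar> powr p) \<partial>M))) \<longlonglongrightarrow> ennreal (C powr p * 2 powr p) * (0 + 0)"
      using F(1) H(1) by (intro tendsto_intros ennreal_tendsto_cmult) auto
    then have "(\<lambda>n. ennreal (C powr p * 2 powr p) * ((\<integral>\<^sup>+x. ennreal (\<bar>Fl x - F n x\<bar> powr p) \<partial>M)
        + (\<integral>\<^sup>+x. ennreal (\<bar>Hl x - H n x\<bar> powr p) \<partial>M))) \<longlonglongrightarrow> 0"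
      by simp
    then show "(\<lambda>n. \<integral>\<^sup>+x. ennreal (?A n x powr p) \<partial>M) \<longlonglongrightarrow> 0"
      by (rule ennreal_tendsto_0_le) (rule sum_le; measurable)
    show "(\<integral>\<^sup>+x. ennreal (?B x powr p) \<partial>M) < \<infinity>"
      by (rule le_less_trans[OF sum_le]) (use F(2) H(2) in \<open>simp_all add: ennreal_mult_less_top\<close>)
    show "AE x in M. \<bar>G n x\<bar> \<le> ?A n x + ?B x" for n
    proof (rule AE_I2)
      fix x
      have "C * (\<bar>F n x\<bar> + \<bar>H n x\<bar>) \<le> C * ((\<bar>Fl x - F n x\<bar> + \<bar>Hl x - H n x\<bar>) + (\<bar>Fl x\<bar> + \<bar>Hl x\<bar>))"
        using C by (intro mult_left_mono) auto
      then show "\<bar>G n x\<bar> \<le> ?A n x + ?B x"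
        using bound[of n x] by (simp only: distrib_left)
    qed
    show "AE x in M. \<bar>Gl x\<bar> \<le> ?B x"
      using F(3) H(3) G
    proof eventually_elim
      case (elim x)
      show ?case
        by (rule LIMSEQ_le[OF tendsto_rabs[OF elim(3)]
              tendsto_mult_left[OF tendsto_add[OF tendsto_rabs[OF elim(1)] tendsto_rabs[OF elim(2)]]]])
           (use bound in auto)
    qed
  qed (use p C G in auto)
qed

text \<open>
  A triangle inequality for p-th powers of norms that loses only a factor close to 1 on the
  function b when \<theta> is small.
\<close>

lemma lp_weighted_triangle:
  fixes a b c :: "'a \<Rightarrow> real"
  assumes [measurable]: "a \<in> borel_measurable M" "b \<in> borel_measurable M" "c \<in> borel_measurable M"
    and "1 \<le> p" "0 < \<theta>" "\<theta> < 1" and le: "\<And>x. \<bar>a x\<bar> \<le> \<bar>b x\<bar> + \<bar>c x\<bar>"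
  shows "(\<integral>\<^sup>+x. ennreal (\<bar>a x\<bar> powr p) \<partial>M)
    \<le> ennreal ((1 - \<theta>) powr (1 - p)) * (\<integral>\<^sup>+x. ennreal (\<bar>b x\<bar> powr p) \<partial>M)
      + ennreal (\<theta> powr (1 - p)) * (\<integral>\<^sup>+x. ennreal (\<bar>c x\<bar> powr p) \<partial>M)"
proof -
  have "(\<integral>\<^sup>+x. ennreal (\<bar>a x\<bar> powr p) \<partial>M)
      \<le> (\<integral>\<^sup>+x. ennreal ((1 - \<theta>) powr (1 - p)) * ennreal (\<bar>b x\<bar> powr p)
        + ennreal (\<theta> powr (1 - p)) * ennreal (\<bar>c x\<bar> powr p) \<partial>M)"
  proof (rule nn_integral_mono)
    fix x
    have "\<bar>a x\<bar> powr p \<le> (\<bar>b x\<bar> + \<bar>c x\<bar>) powr p"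
      using assms(4) le by (intro powr_mono2) auto
    also have "\<dots> \<le> (1 - \<theta>) powr (1 - p) * \<bar>b x\<bar> powr p + \<theta> powr (1 - p) * \<bar>c x\<bar> powr p"
      using assms(4-6) by (intro powr_add_le_weighted) auto
    finally show "ennreal (\<bar>a x\<bar> powr p) \<le> ennreal ((1 - \<theta>) powr (1 - p)) * ennreal (\<bar>b x\<bar> powr p)
        + ennreal (\<theta> powr (1 - p)) * ennreal (\<bar>c x\<bar> powr p)"
      by (simp add: ennreal_leI flip: ennreal_mult ennreal_plus)
  qed
  also have "\<dots> = ennreal ((1 - \<theta>) powr (1 - p)) * (\<integral>\<^sup>+x. ennreal (\<bar>b x\<bar> powr p) \<partial>M)
      + ennreal (\<theta> powr (1 - p)) * (\<integral>\<^sup>+x. ennreal (\<bar>c x\<bar> powr p) \<partial>M)"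
    by (subst nn_integral_add) (simp_all add: nn_integral_cmult)
  finally show ?thesis .
qed

text \<open>
  Young's inequality |u| m^(p-1) \<le> |u|^p / p + (1 - 1/p) m^p, integrated with m the mean value
  of |u|, is Jensen's inequality in the form that also covers measures of total mass other than 1.
\<close>

lemma (in finite_measure) integral_abs_powr_le:
  fixes u :: "'a \<Rightarrow> real"
  assumes "1 < p" and u: "integrable M u" and up: "integrable M (\<lambda>x. \<bar>u x\<bar> powr p)"
  shows "(\<integral>x. \<bar>u x\<bar> \<partial>M) powr p \<le> measure M (space M) powr (p - 1) * (\<integral>x. \<bar>u x\<bar> powr p \<partial>M)"
proof -
  let ?A = "\<integral>x. \<bar>u x\<bar> \<partial>M" and ?P = "\<integral>x. \<bar>u x\<bar> powr p \<partial>M" and ?V = "measure M (space M)"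
  have P: "0 \<le> ?P" and A: "0 \<le> ?A" by auto
  show ?thesis
  proof (cases "?A = 0")
    case True
    then show ?thesis using P by simp
  next
    case False
    have "?V \<noteq> 0"
    proof
      assume "?V = 0"
      then have "AE x in M. \<bar>u x\<bar> = 0"
        by (intro AE_I[where N = "space M"]) (auto simp: emeasure_eq_measure)
      then have "?A = (\<integral>x. 0 \<partial>M)" using u by (intro integral_cong_AE) auto
      then show False using False by simp
    qed
    then have V: "0 < ?V" by (simp add: zero_less_measure_iff)
    define m where "m = ?A / ?V"
    have m: "0 < m" unfolding m_def using V A False by (intro divide_pos_pos) linarith+
    have young: "\<bar>u x\<bar> * m powr (p - 1) \<le> \<bar>u x\<bar> powr p / p + m powr p * (1 - 1 / p)" for x
    proof -
      have "1 / p + 1 / (p / (p - 1)) = 1" "1 < p / (p - 1)"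
        using assms(1) by (auto simp: field_simps)
      from Youngs_inequality[OF assms(1) this(2,1), of "\<bar>u x\<bar>" "m powr (p - 1)"]
      have "\<bar>u x\<bar> * m powr (p - 1) \<le> \<bar>u x\<bar> powr p / p + m powr ((p - 1) * (p / (p - 1))) / (p / (p - 1))"
        by (simp add: powr_powr)
      moreover have "(p - 1) * (p / (p - 1)) = p" "m powr p / (p / (p - 1)) = m powr p * (1 - 1 / p)"
        using assms(1) by (auto simp: field_simps)
      ultimately show ?thesis by simp
    qed
    have "?A * m powr (p - 1) = (\<integral>x. \<bar>u x\<bar> * m powr (p - 1) \<partial>M)"
      using u by simp
    also have "\<dots> \<le> (\<integral>x. \<bar>u x\<bar> powr p / p + m powr p * (1 - 1 / p) \<partial>M)"
      using u up young by (intro integral_mono) auto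
    also have "\<dots> = ?P / p + m powr p * (1 - 1 / p) * ?V"
      using up by simp
    finally have "?A * m powr (p - 1) \<le> ?P / p + m powr p * (1 - 1 / p) * ?V" .
    moreover have "?A * m powr (p - 1) = m powr p * ?V"
      using V m by (simp add: m_def powr_diff field_simps)
    ultimately have "m powr p * ?V \<le> ?P"
      using assms(1) by (simp add: field_simps)
    moreover have "?A powr p = ?V powr (p - 1) * (m powr p * ?V)"
      using V A by (simp add: m_def powr_divide powr_diff)
    ultimately show ?thesis
      by (simp add: mult_left_mono)
  qed
qed

section \<open>Pairs of points and the truncated singular kernel\<close>

lemma sigma_finite_completion:
  assumes "sigma_finite_measure M"
  shows "sigma_finite_measure (completion M)"
proof -
  interpret sigma_finite_measure M by fact
  obtain A where "countable A" "A \<subseteq> sets M" "\<Union>A = space M" "\<forall>a\<in>A. emeasure M a \<noteq> \<infinity>"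
    using sigma_finite_countable by blast
  then show ?thesis
    by (intro sigma_finite_measure.intro exI[of _ A])
       (auto simp: subset_eq emeasure_completion main_part_sets)
qed

lemma pair_sigma_finite_lebesgue: "pair_sigma_finite lebesgue lebesgue"
  by (intro pair_sigma_finite.intro sigma_finite_completion sigma_finite_lborel)

lemma borel_measurable_imp_lebesgue_measurable:
  "f \<in> borel_measurable borel \<Longrightarrow> f \<in> borel_measurable lebesgue"
  by (rule measurable_completion) simp

lemma pair_diff_measurable [measurable]:
  "(\<lambda>z. fst z - snd z) \<in> borel_measurable (lebesgue \<Otimes>\<^sub>M (lebesgue :: 'a::euclidean_space measure))"
proof -
  have "(\<lambda>x. x) \<in> borel_measurable (lebesgue :: 'a measure)"
    by (rule borel_measurable_imp_lebesgue_measurable) simp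
  from measurable_compose[OF measurable_fst this] measurable_compose[OF measurable_snd this]
  show ?thesis by (rule borel_measurable_diff)
qed

text \<open>
  The exceptional set is covered by two strips over a null set, so P itself may be arbitrary.
\<close>

lemma AE_pair_fst_snd:
  assumes "AE x in lebesgue. P x"
  shows "AE z in lebesgue \<Otimes>\<^sub>M (lebesgue :: 'a::euclidean_space measure). P (fst z) \<and> P (snd z)"
proof -
  interpret pair_sigma_finite "lebesgue :: 'a measure" "lebesgue :: 'a measure"
    by (rule pair_sigma_finite_lebesgue)
  obtain N where N: "{x. \<not> P x} \<subseteq> N" "N \<in> null_sets (lebesgue :: 'a measure)"
    using assms by (auto simp: eventually_ae_filter)
  have "N \<times> UNIV \<in> null_sets (lebesgue \<Otimes>\<^sub>M (lebesgue :: 'a measure))"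
       "UNIV \<times> N \<in> null_sets (lebesgue \<Otimes>\<^sub>M (lebesgue :: 'a measure))"
    using N by (auto intro!: times_in_null_sets1 times_in_null_sets2)
  then have "N \<times> UNIV \<union> UNIV \<times> N \<in> null_sets (lebesgue \<Otimes>\<^sub>M (lebesgue :: 'a measure))"
    by (rule null_sets.Un)
  then show ?thesis
    by (rule AE_I') (use N in \<open>auto simp: subset_eq\<close>)
qed

lemma dyadic_shell_exists:
  fixes t :: real
  assumes "0 < t"
  shows "(\<exists>k::nat. 2 powr real k \<le> t \<and> t < 2 powr (real k + 1))
       \<or> (\<exists>k::nat. 2 powr (- real k - 1) \<le> t \<and> t < 2 powr (- real k))"
proof -
  define m where "m = \<lfloor>log 2 t\<rfloor>"
  have m: "2 powr m \<le> t" "t < 2 powr (m + 1)"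
    using floor_log_eq_powr_iff[of t 2 m] assms by (auto simp: m_def)
  show ?thesis
  proof (cases "0 \<le> m")
    case True
    then show ?thesis using m by (intro disjI1 exI[of _ "nat m"]) auto
  next
    case False
    then have "real (nat (- m - 1)) = - real_of_int m - 1" by simp
    then show ?thesis using m by (intro disjI2 exI[of _ "nat (- m - 1)"]) (simp add: add.commute)
  qed
qed

lemma suminf_geometric_powr_finite:
  assumes "0 < (a::real)" "0 \<le> C"
  shows "(\<Sum>k. ennreal (C * 2 powr (- a * real k))) < \<infinity>"
proof -
  have eq: "2 powr (- a * real k) = (2 powr (- a)) ^ k" for k
    by (simp add: powr_power mult.commute)
  have "norm (2 powr (- a)) < (1::real)"
    using powr_less_mono[of "- a" 0 2] assms by simp
  then have "summable (\<lambda>k. C * (2 powr (- a)) ^ k)"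
    by (intro summable_mult summable_geometric)
  moreover have "0 \<le> C * (2 powr (- a)) ^ k" for k
    using assms by (intro mult_nonneg_nonneg zero_le_power) auto
  ultimately show ?thesis
    unfolding eq infinity_ennreal_def less_top[symmetric] by (rule ennreal_suminf_neq_top)
qed

text \<open>
  A dyadic shell of radius 2^k has volume of order 2^(k N), where N is the dimension. Hence the
  shells outside the unit ball contribute terms of order 2^(-k q), and the shells of radius 2^(-k)
  inside it contribute terms of order 2^(-k (p - q)). Both geometric series converge because
  0 < q < p.
\<close>

lemma truncated_kernel_integrable:
  fixes p q :: real
  assumes "0 < q" "q < p"
  shows "(\<integral>\<^sup>+z. ennreal (min 1 (norm z) powr p / norm z powr (real DIM('a) + q))
    \<partial>(lborel :: 'a::euclidean_space measure)) < \<infinity>"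
proof -
  let ?N = "real DIM('a)"
  let ?a = "\<lambda>k::nat. 2 powr (- real k * (?N + q))"
  let ?b = "\<lambda>k::nat. 2 powr ((real k + 1) * (?N + q) - real k * p)"
  let ?B = "\<lambda>r. ball (0::'a) r"
  have ball_vol: "ennreal (2 powr a) * emeasure lborel (?B (2 powr r))
      = ennreal (unit_ball_vol ?N * 2 powr (a + ?N * r))" for a r
  proof -
    have "(2 powr r) ^ DIM('a) = 2 powr (?N * r)"
      by (simp add: powr_power)
    then show ?thesis
      by (simp add: emeasure_ball powr_add mult_ac flip: ennreal_mult)
  qed
  have integrate_series: "(\<integral>\<^sup>+z. (\<Sum>k. ennreal (c k) * indicator (?B (r k)) z) \<partial>lborel)
      = (\<Sum>k. ennreal (c k) * emeasure lborel (?B (r k)))" for c r :: "nat \<Rightarrow> real"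
    by (subst nn_integral_suminf)
       (auto simp: nn_integral_cmult_indicator intro!: borel_measurable_times_ennreal borel_measurable_indicator)
  have series_measurable: "(\<lambda>z. \<Sum>k. ennreal (c k) * indicator (?B (r k)) z) \<in> borel_measurable lborel"
    for c r :: "nat \<Rightarrow> real"
    by (intro borel_measurable_suminf_order borel_measurable_times_ennreal borel_measurable_indicator) auto
  have "(\<integral>\<^sup>+z. ennreal (min 1 (norm z) powr p / norm z powr (?N + q)) \<partial>(lborel :: 'a measure))
    \<le> (\<integral>\<^sup>+z. (\<Sum>k. ennreal (?a k) * indicator (?B (2 powr (real k + 1))) z)
          + (\<Sum>k. ennreal (?b k) * indicator (?B (2 powr (- real k))) z) \<partial>lborel)"
  proof (rule nn_integral_mono)
    fix z :: 'a
    let ?S1 = "\<Sum>k. ennreal (?a k) * indicator (?B (2 powr (real k + 1))) z"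
    let ?S2 = "\<Sum>k. ennreal (?b k) * indicator (?B (2 powr (- real k))) z"
    let ?t = "norm z"
    have S1: "ennreal (?a k) \<le> ?S1" if "norm z < 2 powr (real k + 1)" for k
      using sum_le_suminf[OF summableI, of "{k}" "\<lambda>k. ennreal (?a k) * indicator (?B (2 powr (real k + 1))) z"] that
      by simp
    have S2: "ennreal (?b k) \<le> ?S2" if "norm z < 2 powr (- real k)" for k
      using sum_le_suminf[OF summableI, of "{k}" "\<lambda>k. ennreal (?b k) * indicator (?B (2 powr (- real k))) z"] that
      by simp
    consider "z = 0"
      | k :: nat where "2 powr real k \<le> ?t" "?t < 2 powr (real k + 1)"
      | k :: nat where "2 powr (- real k - 1) \<le> ?t" "?t < 2 powr (- real k)"
      using dyadic_shell_exists[of ?t] by fastforce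
    then show "ennreal (min 1 ?t powr p / ?t powr (?N + q)) \<le> ?S1 + ?S2"
    proof cases
      case (2 k)
      have "(2 powr real k) powr (?N + q) \<le> ?t powr (?N + q)"
        using 2 assms by (intro powr_mono2) auto
      then have "min 1 ?t powr p / ?t powr (?N + q) \<le> 1 / (2 powr real k) powr (?N + q)"
        using assms by (intro frac_le powr_le1) auto
      also have "\<dots> = ?a k"
        by (simp add: powr_powr powr_minus_divide)
      finally have "ennreal (min 1 ?t powr p / ?t powr (?N + q)) \<le> ennreal (?a k)"
        by (rule ennreal_leI)
      also have "\<dots> \<le> ?S1 + ?S2"
        using S1[OF 2(2)] by (simp add: add_increasing2)
      finally show ?thesis .
    next
      case (3 k)
      have "(2 powr (- real k - 1)) powr (?N + q) \<le> ?t powr (?N + q)"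
        using 3 assms by (intro powr_mono2) auto
      moreover have "min 1 ?t powr p \<le> (2 powr (- real k)) powr p"
        using 3 assms by (intro powr_mono2) auto
      ultimately have "min 1 ?t powr p / ?t powr (?N + q)
          \<le> (2 powr (- real k)) powr p / (2 powr (- real k - 1)) powr (?N + q)"
        by (intro frac_le) auto
      also have "\<dots> = 2 powr (- real k * p - (- real k - 1) * (?N + q))"
        by (simp add: powr_powr flip: powr_diff)
      also have "\<dots> = ?b k"
        by (simp add: algebra_simps)
      finally have "ennreal (min 1 ?t powr p / ?t powr (?N + q)) \<le> ennreal (?b k)"
        by (rule ennreal_leI)
      also have "\<dots> \<le> ?S1 + ?S2"
        using S2[OF 3(2)] by (simp add: add_increasing)
      finally show ?thesis .
    qed simp
  qed
  also have "\<dots> = (\<Sum>k. ennreal (?a k) * emeasure lborel (?B (2 powr (real k + 1))))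
      + (\<Sum>k. ennreal (?b k) * emeasure lborel (?B (2 powr (- real k))))"
    unfolding nn_integral_add[OF series_measurable series_measurable] integrate_series ..
  also have "\<dots> = (\<Sum>k. ennreal (unit_ball_vol ?N * 2 powr ?N * 2 powr (- q * real k)))
      + (\<Sum>k. ennreal (unit_ball_vol ?N * 2 powr (?N + q) * 2 powr (- (p - q) * real k)))"
  proof -
    have "ennreal (?a k) * emeasure lborel (?B (2 powr (real k + 1)))
        = ennreal (unit_ball_vol ?N * 2 powr ?N * 2 powr (- q * real k))" for k
    proof -
      have "- real k * (?N + q) + ?N * (real k + 1) = ?N + - q * real k"
        by (simp add: algebra_simps)
      then have "2 powr (- real k * (?N + q) + ?N * (real k + 1)) = 2 powr ?N * 2 powr (- q * real k)"
        by (simp only: powr_add)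
      with ball_vol[of "- real k * (?N + q)" "real k + 1"] show ?thesis
        by (simp only: mult.assoc)
    qed
    moreover have "ennreal (?b k) * emeasure lborel (?B (2 powr (- real k)))
        = ennreal (unit_ball_vol ?N * 2 powr (?N + q) * 2 powr (- (p - q) * real k))" for k
    proof -
      have "(real k + 1) * (?N + q) - real k * p + ?N * (- real k) = (?N + q) + - (p - q) * real k"
        by (simp add: algebra_simps)
      then have "2 powr ((real k + 1) * (?N + q) - real k * p + ?N * (- real k))
          = 2 powr (?N + q) * 2 powr (- (p - q) * real k)"
        by (simp only: powr_add)
      with ball_vol[of "(real k + 1) * (?N + q) - real k * p" "- real k"] show ?thesis
        by (simp only: mult.assoc)
    qed
    ultimately show ?thesis by (simp only:)
  qed
  also have "\<dots> < \<infinity>"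
    unfolding infinity_ennreal_def ennreal_add_less_top
    using assms by (intro conjI suminf_geometric_powr_finite[unfolded infinity_ennreal_def])
      (auto intro!: mult_nonneg_nonneg unit_ball_vol_nonneg)
  finally show ?thesis .
qed

section \<open>The Gagliardo energy and approximation by test functions\<close>

definition pair_diff :: "('a \<Rightarrow> real) \<Rightarrow> 'a \<times> 'a \<Rightarrow> real" where
  "pair_diff u z = u (fst z) - u (snd z)"

text \<open>
  With the singular kernel as a density, the p-th power of the Gagliardo seminorm is the integral
  of the p-th power of the difference function, and only results on p-th means are needed. The
  parameter q stands for the product of s and p. On the diagonal the density is 1 / 0 = 0.
\<close>

definition gagliardo_measure :: "real \<Rightarrow> ('a::euclidean_space \<times> 'a) measure" where
  "gagliardo_measure q = density (lebesgue \<Otimes>\<^sub>M lebesgue)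
     (\<lambda>z. ennreal (1 / norm (fst z - snd z) powr (real DIM('a) + q)))"

text \<open>
  The p-th powers of the two seminorms of W0 are used throughout, since they are plain integrals
  and weak forms of the triangle inequality are enough for them.
\<close>

definition energy :: "real \<Rightarrow> real \<Rightarrow> ('a::euclidean_space \<Rightarrow> real) \<Rightarrow> ennreal" where
  "energy s p u = (\<integral>\<^sup>+z. ennreal (\<bar>pair_diff u z\<bar> powr p) \<partial>gagliardo_measure (s * p))"

definition mass :: "real \<Rightarrow> ('a::euclidean_space \<Rightarrow> real) \<Rightarrow> ennreal" where
  "mass p u = (\<integral>\<^sup>+x. ennreal (\<bar>u x\<bar> powr p) \<partial>lebesgue)"

lemma sets_gagliardo_measure [measurable_cong, simp]:
  "sets (gagliardo_measure q) = sets (lebesgue \<Otimes>\<^sub>M lebesgue)"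
  by (simp add: gagliardo_measure_def)

lemma measurable_fst_lebesgue: "u \<in> borel_measurable lebesgue \<Longrightarrow> (\<lambda>z. u (fst z)) \<in> borel_measurable (lebesgue \<Otimes>\<^sub>M lebesgue)"
  and measurable_snd_lebesgue: "u \<in> borel_measurable lebesgue \<Longrightarrow> (\<lambda>z. u (snd z)) \<in> borel_measurable (lebesgue \<Otimes>\<^sub>M lebesgue)"
  by (rule measurable_compose[OF measurable_fst], assumption)
     (rule measurable_compose[OF measurable_snd], assumption)

lemma pair_diff_borel_measurable [measurable]:
  "u \<in> borel_measurable lebesgue \<Longrightarrow> pair_diff u \<in> borel_measurable (lebesgue \<Otimes>\<^sub>M lebesgue)"
  unfolding pair_diff_def[abs_def]
  by (intro borel_measurable_diff measurable_fst_lebesgue measurable_snd_lebesgue)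

lemma kernel_measurable [measurable]:
  "(\<lambda>z. 1 / norm (fst z - snd z) powr r) \<in> borel_measurable (lebesgue \<Otimes>\<^sub>M (lebesgue :: 'a::euclidean_space measure))"
  by measurable

lemma AE_gagliardo_measureI:
  assumes "AE z in lebesgue \<Otimes>\<^sub>M (lebesgue :: 'a::euclidean_space measure). P z"
  shows "AE z in gagliardo_measure q. P z"
  unfolding gagliardo_measure_def using assms by (subst AE_density) (auto elim: eventually_mono)

lemma AE_gagliardo_measure_pair:
  assumes "AE x in lebesgue. P x"
  shows "AE z in gagliardo_measure q. P (fst z) \<and> P (snd z)"
  by (rule AE_gagliardo_measureI[OF AE_pair_fst_snd[OF assms]])

lemma gagliardo_eq_energy:
  assumes [measurable]: "u \<in> borel_measurable lebesgue"
  shows "gagliardo s p u = epowr (energy s p u) (1 / p)"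
proof -
  have "energy s p u = (\<integral>\<^sup>+(x, y). ennreal (\<bar>u x - u y\<bar> powr p / norm (x - y) powr (real DIM('a) + s * p))
        \<partial>(lebesgue \<Otimes>\<^sub>M lebesgue))"
    unfolding energy_def gagliardo_measure_def
    by (subst nn_integral_density)
       (auto simp: pair_diff_def split_beta mult.commute simp flip: ennreal_mult intro!: nn_integral_cong)
  then show ?thesis by (simp add: gagliardo_def)
qed

lemma frac_plap_eq:
  assumes [measurable]: "u \<in> borel_measurable lebesgue" "v \<in> borel_measurable lebesgue"
  shows "frac_plap s p u v
    = (\<integral>z. signed_power p (pair_diff u z) * pair_diff v z \<partial>gagliardo_measure (s * p))"
  unfolding frac_plap_def gagliardo_measure_def
  by (subst integral_density)
     (auto simp: pair_diff_def signed_power_def split_beta intro!: Bochner_Integration.integral_cong)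

lemma Lnorm_eq_mass:
  assumes "\<Omega> \<in> sets lebesgue" and "AE x in lebesgue. x \<notin> \<Omega> \<longrightarrow> u x = 0"
  shows "Lnorm p \<Omega> u = epowr (mass p u) (1 / p)"
proof -
  have "(\<integral>\<^sup>+x. ennreal (\<bar>u x\<bar> powr p) \<partial>lebesgue_on \<Omega>) = mass p u"
    unfolding mass_def using assms
    by (subst nn_integral_restrict_space) (auto intro!: nn_integral_cong_AE elim!: eventually_mono simp: indicator_def)
  then show ?thesis by (simp add: Lnorm_def)
qed

lemma epowr_less_iff:
  assumes "0 < p" "0 < t"
  shows "epowr x (1 / p) < ennreal t \<longleftrightarrow> x < ennreal (t powr p)"
proof (cases x)
  case (real r)
  have "r powr (1 / p) < t \<longleftrightarrow> r < t powr p"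
    using real assms powr_less_mono2[of p "r powr (1/p)" t] powr_less_mono2[of "1/p" r "t powr p"]
      powr_mono2[of p t "r powr (1/p)"]
    by (auto simp: powr_powr not_less)
  then show ?thesis
    using real assms by (simp add: epowr_def ennreal_less_iff)
qed (simp add: epowr_def)

lemma test_function_measurable:
  assumes "test_function \<Omega> f"
  shows "f \<in> borel_measurable lebesgue"
  using test_function_continuous[OF assms]
  by (intro borel_measurable_imp_lebesgue_measurable borel_measurable_continuous_onI)

lemma test_function_zero_outside: "test_function \<Omega> f \<Longrightarrow> x \<notin> \<Omega> \<Longrightarrow> f x = 0"
  unfolding test_function_def using closure_subset[of "{x. f x \<noteq> 0}"] by blast

lemma W0_measurable: "u \<in> W0 s p \<Omega> \<Longrightarrow> u \<in> borel_measurable lebesgue"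
  and W0_zero_outside: "u \<in> W0 s p \<Omega> \<Longrightarrow> AE x in lebesgue. x \<notin> \<Omega> \<longrightarrow> u x = 0"
  by (simp_all add: W0_def)

lemma W0I:
  assumes p: "0 < p" and \<Omega>: "\<Omega> \<in> sets lebesgue"
    and u [measurable]: "u \<in> borel_measurable lebesgue" and zero: "AE x in lebesgue. x \<notin> \<Omega> \<longrightarrow> u x = 0"
    and f: "\<And>n. test_function \<Omega> (f n)"
    and E: "(\<lambda>n. energy s p (\<lambda>x. u x - f n x)) \<longlonglongrightarrow> 0"
    and M: "(\<lambda>n. mass p (\<lambda>x. u x - f n x)) \<longlonglongrightarrow> 0"
  shows "u \<in> W0 s p \<Omega>"
  unfolding W0_def mem_Collect_eq
proof (intro conjI allI impI u zero)
  fix \<epsilon> :: ennreal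
  assume "0 < \<epsilon>"
  then obtain t where t: "0 < t" "ennreal (2 * t) \<le> \<epsilon>"
  proof (cases \<epsilon>)
    case (real r)
    then show ?thesis using \<open>0 < \<epsilon>\<close> by (intro that[of "r / 2"]) auto
  next
    case top
    then show ?thesis by (intro that[of 1]) auto
  qed
  have "0 < ennreal (t powr p)" using t by simp
  then have "\<forall>\<^sub>F n in sequentially. energy s p (\<lambda>x. u x - f n x) < ennreal (t powr p)
      \<and> mass p (\<lambda>x. u x - f n x) < ennreal (t powr p)"
    using order_tendstoD(2)[OF E] order_tendstoD(2)[OF M] by (intro eventually_conj) auto
  then obtain n where n: "energy s p (\<lambda>x. u x - f n x) < ennreal (t powr p)"
      "mass p (\<lambda>x. u x - f n x) < ennreal (t powr p)"
    using eventually_happens'[OF sequentially_bot] by blast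
  note [measurable] = test_function_measurable[OF f]
  have "AE x in lebesgue. x \<notin> \<Omega> \<longrightarrow> u x - f n x = 0"
    using zero by eventually_elim (simp add: test_function_zero_outside[OF f])
  then have "gagliardo s p (\<lambda>x. u x - f n x) < ennreal t" "Lnorm p \<Omega> (\<lambda>x. u x - f n x) < ennreal t"
    using n p t \<Omega> by (simp_all add: gagliardo_eq_energy Lnorm_eq_mass epowr_less_iff)
  then have "gagliardo s p (\<lambda>x. u x - f n x) + Lnorm p \<Omega> (\<lambda>x. u x - f n x) < ennreal t + ennreal t"
    by (rule add_strict_mono)
  also have "\<dots> \<le> \<epsilon>"
    using t by (simp flip: ennreal_plus)
  finally show "\<exists>f. test_function \<Omega> f \<and>
      gagliardo s p (\<lambda>x. u x - f x) + Lnorm p \<Omega> (\<lambda>x. u x - f x) < \<epsilon>"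
    using f by blast
qed

text \<open>
  The series of the p-th powers of the errors has a finite integral, so it converges almost
  everywhere and its terms tend to 0.
\<close>

lemma AE_tendsto_of_mass_le_geometric:
  assumes p: "0 < p" and [measurable]: "u \<in> borel_measurable lebesgue" "\<And>n. f n \<in> borel_measurable lebesgue"
    and M: "\<And>n. mass p (\<lambda>x. u x - f n x) \<le> ennreal ((1 / 2) ^ n)"
  shows "AE x in lebesgue. (\<lambda>n. f n x) \<longlonglongrightarrow> u x"
proof -
  have "(\<integral>\<^sup>+x. (\<Sum>n. ennreal (\<bar>u x - f n x\<bar> powr p)) \<partial>lebesgue) = (\<Sum>n. mass p (\<lambda>x. u x - f n x))"
    unfolding mass_def by (rule nn_integral_suminf) measurable
  also have "\<dots> \<le> (\<Sum>n. ennreal ((1 / 2) ^ n))"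
    by (intro suminf_le M summableI)
  also have "\<dots> < \<infinity>"
    unfolding infinity_ennreal_def less_top[symmetric]
    by (rule ennreal_suminf_neq_top) (auto intro: summable_geometric)
  finally have "AE x in lebesgue. (\<Sum>n. ennreal (\<bar>u x - f n x\<bar> powr p)) \<noteq> \<infinity>"
    by (intro nn_integral_PInf_AE) auto
  then show ?thesis
  proof eventually_elim
    case (elim x)
    then have "summable (\<lambda>n. \<bar>u x - f n x\<bar> powr p)"
      by (intro summable_suminf_not_top) auto
    then have "(\<lambda>n. (\<bar>u x - f n x\<bar> powr p) powr (1 / p)) \<longlonglongrightarrow> 0 powr (1 / p)"
      using p by (intro tendsto_powr' summable_LIMSEQ_zero) auto
    then have "(\<lambda>n. \<bar>u x - f n x\<bar>) \<longlonglongrightarrow> 0"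
      using p by (simp add: powr_powr)
    then have "(\<lambda>n. u x - (u x - f n x)) \<longlonglongrightarrow> u x - 0"
      by (intro tendsto_intros) (simp add: tendsto_rabs_zero_iff)
    then show ?case by simp
  qed
qed

text \<open>
  The approximations are chosen with errors at most 2^(-n). Such errors are summable, which gives
  convergence almost everywhere along the whole sequence, without passing to a subsequence.
\<close>

lemma W0E:
  assumes p: "0 < p" and \<Omega>: "\<Omega> \<in> sets lebesgue" and u: "u \<in> W0 s p \<Omega>"
  obtains f where "\<And>n. test_function \<Omega> (f n)"
    and "(\<lambda>n. energy s p (\<lambda>x. u x - f n x)) \<longlonglongrightarrow> 0"
    and "(\<lambda>n. mass p (\<lambda>x. u x - f n x)) \<longlonglongrightarrow> 0"
    and "AE x in lebesgue. (\<lambda>n. f n x) \<longlonglongrightarrow> u x"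
proof -
  note [measurable] = W0_measurable[OF u]
  have "\<exists>f. test_function \<Omega> f \<and> energy s p (\<lambda>x. u x - f x) \<le> ennreal ((1 / 2) ^ n)
      \<and> mass p (\<lambda>x. u x - f x) \<le> ennreal ((1 / 2) ^ n)" for n
  proof -
    \<comment> \<open>The tolerance for the norms whose p-th power is 2^(-n).\<close>
    define t :: real where "t = ((1 / 2) ^ n) powr (1 / p)"
    have t: "0 < t" "t powr p = (1 / 2) ^ n"
      using p by (auto simp: t_def powr_powr)
    then have "0 < ennreal t" by simp
    then obtain f where f: "test_function \<Omega> f"
        "gagliardo s p (\<lambda>x. u x - f x) + Lnorm p \<Omega> (\<lambda>x. u x - f x) < ennreal t"
      using u unfolding W0_def by blast
    note [measurable] = test_function_measurable[OF f(1)]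
    have "AE x in lebesgue. x \<notin> \<Omega> \<longrightarrow> u x - f x = 0"
      using W0_zero_outside[OF u] by eventually_elim (simp add: test_function_zero_outside[OF f(1)])
    moreover have "gagliardo s p (\<lambda>x. u x - f x) < ennreal t" "Lnorm p \<Omega> (\<lambda>x. u x - f x) < ennreal t"
      using f(2) by (auto elim: le_less_trans[rotated])
    ultimately show ?thesis
      using f(1) t p \<Omega> by (intro exI[of _ f]) (simp add: gagliardo_eq_energy Lnorm_eq_mass epowr_less_iff less_imp_le)
  qed
  then obtain f where f: "\<And>n. test_function \<Omega> (f n)"
      "\<And>n. energy s p (\<lambda>x. u x - f n x) \<le> ennreal ((1 / 2) ^ n)"
      "\<And>n. mass p (\<lambda>x. u x - f n x) \<le> ennreal ((1 / 2) ^ n)"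
    by metis
  have lim: "(\<lambda>n. ennreal ((1 / 2) ^ n)) \<longlonglongrightarrow> 0"
    using tendsto_ennrealI[OF LIMSEQ_realpow_zero[of "1 / 2"]] by simp
  show ?thesis
    by (rule that[OF f(1) ennreal_tendsto_0_le[OF lim f(2)] ennreal_tendsto_0_le[OF lim f(3)]
        AE_tendsto_of_mass_le_geometric[OF p W0_measurable[OF u] test_function_measurable[OF f(1)] f(3)]])
qed

lemma mass_test_function_finite:
  assumes f: "test_function \<Omega> f" and "0 < p"
  shows "mass p f < \<infinity>"
proof -
  let ?K = "closure {x. f x \<noteq> 0}"
  obtain M where M: "M > 0" "\<And>x. \<bar>f x\<bar> \<le> M"
    using test_function_bounded[OF f] by blast
  have K: "?K \<in> lmeasurable"
    using f by (intro lmeasurable_compact) (simp add: test_function_def)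
  have "mass p f \<le> (\<integral>\<^sup>+x. ennreal (M powr p) * indicator ?K x \<partial>lebesgue)"
    unfolding mass_def
  proof (rule nn_integral_mono)
    fix x
    have "\<bar>f x\<bar> powr p \<le> M powr p"
      using M assms by (intro powr_mono2) auto
    moreover have "f x = 0" if "x \<notin> ?K"
      using that closure_subset[of "{x. f x \<noteq> 0}"] by blast
    ultimately show "ennreal (\<bar>f x\<bar> powr p) \<le> ennreal (M powr p) * indicator ?K x"
      by (cases "x \<in> ?K") (auto intro: ennreal_leI)
  qed
  also have "\<dots> = ennreal (M powr p) * emeasure lebesgue ?K"
    using K by (intro nn_integral_cmult_indicator) auto
  also have "\<dots> < \<infinity>"
    using fmeasurableD2[OF K] by (simp add: ennreal_mult_less_top top.not_eq_extremum)
  finally show ?thesis .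
qed

text \<open>
  By translation invariance and evenness, each section of the integrand over a point of K has the
  same integral as k.
\<close>

lemma nn_integral_kernel_slab:
  fixes k :: "'a::euclidean_space \<Rightarrow> ennreal"
  assumes [measurable]: "k \<in> borel_measurable borel" and even: "\<And>z. k (- z) = k z"
    and [measurable]: "K \<in> sets lebesgue"
  shows "(\<integral>\<^sup>+z. k (fst z - snd z) * indicator K (fst z) \<partial>(lebesgue \<Otimes>\<^sub>M lebesgue))
      = (\<integral>\<^sup>+z. k z \<partial>lborel) * emeasure lebesgue K"
    and "(\<integral>\<^sup>+z. k (fst z - snd z) * indicator K (snd z) \<partial>(lebesgue \<Otimes>\<^sub>M lebesgue))
      = (\<integral>\<^sup>+z. k z \<partial>lborel) * emeasure lebesgue K"
proof -
  interpret pair_sigma_finite "lebesgue :: 'a measure" "lebesgue :: 'a measure"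
    by (rule pair_sigma_finite_lebesgue)
  have kd: "(\<lambda>z. k (fst z - snd z)) \<in> borel_measurable (lebesgue \<Otimes>\<^sub>M lebesgue)"
    by (rule measurable_compose[OF pair_diff_measurable]) measurable
  have translate: "(\<integral>\<^sup>+y. k (y - x) \<partial>lebesgue) = (\<integral>\<^sup>+z. k z \<partial>lborel)" for x
  proof -
    have "(\<integral>\<^sup>+z. k z \<partial>lborel) = (\<integral>\<^sup>+z. k z \<partial>distr lborel borel ((+) (- x)))"
      by (simp add: lborel_distr_plus)
    also have "\<dots> = (\<integral>\<^sup>+y. k (- x + y) \<partial>lborel)"
      by (rule nn_integral_distr) auto
    finally show ?thesis by (simp add: nn_integral_completion)
  qed
  have sections: "(\<integral>\<^sup>+y. k (y - x) * c \<partial>lebesgue) = (\<integral>\<^sup>+z. k z \<partial>lborel) * c"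
      "(\<integral>\<^sup>+y. k (x - y) * c \<partial>lebesgue) = (\<integral>\<^sup>+z. k z \<partial>lborel) * c" for x c
  proof -
    show "(\<integral>\<^sup>+y. k (y - x) * c \<partial>lebesgue) = (\<integral>\<^sup>+z. k z \<partial>lborel) * c"
      unfolding translate[of x, symmetric]
      by (rule nn_integral_multc, rule borel_measurable_imp_lebesgue_measurable) measurable
    then show "(\<integral>\<^sup>+y. k (x - y) * c \<partial>lebesgue) = (\<integral>\<^sup>+z. k z \<partial>lborel) * c"
      using even[of "x - y" for y] by simp
  qed
  have m1: "(\<lambda>z. k (fst z - snd z) * indicator K (fst z)) \<in> borel_measurable (lebesgue \<Otimes>\<^sub>M lebesgue)"
    by (intro borel_measurable_times_ennreal kd measurable_compose[OF measurable_fst]) measurable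
  have m2: "(\<lambda>z. k (fst z - snd z) * indicator K (snd z)) \<in> borel_measurable (lebesgue \<Otimes>\<^sub>M lebesgue)"
    by (intro borel_measurable_times_ennreal kd measurable_compose[OF measurable_snd]) measurable
  have ind: "(\<integral>\<^sup>+x. c * indicator K x \<partial>lebesgue) = c * emeasure lebesgue K" for c :: ennreal
    by (rule nn_integral_cmult_indicator) measurable
  show "(\<integral>\<^sup>+z. k (fst z - snd z) * indicator K (fst z) \<partial>(lebesgue \<Otimes>\<^sub>M lebesgue))
      = (\<integral>\<^sup>+z. k z \<partial>lborel) * emeasure lebesgue K"
    unfolding M1.nn_integral_fst[OF m1, symmetric] fst_conv snd_conv sections ind ..
  show "(\<integral>\<^sup>+z. k (fst z - snd z) * indicator K (snd z) \<partial>(lebesgue \<Otimes>\<^sub>M lebesgue))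
      = (\<integral>\<^sup>+z. k z \<partial>lborel) * emeasure lebesgue K"
    unfolding nn_integral_snd[OF m2, symmetric] fst_conv snd_conv sections ind ..
qed

text \<open>
  The Lipschitz bound near the diagonal and the boundedness away from it combine to
  |f x - f y| \<le> (2 M + L) min 1 |x - y|, and the difference vanishes unless x or y lies in the
  support. Integrating over one variable leaves the truncated kernel.
\<close>

lemma energy_test_function_finite:
  fixes f :: "'a::euclidean_space \<Rightarrow> real"
  assumes f: "test_function \<Omega> f" and s: "0 < s" "s < 1" and p: "0 < p"
  shows "energy s p f < \<infinity>"
proof -
  let ?K = "closure {x. f x \<noteq> 0}"
  let ?N = "real DIM('a)"
  define k where "k z = ennreal (min 1 (norm z) powr p / norm z powr (?N + s * p))" for z :: 'a
  have [measurable]: "k \<in> borel_measurable borel"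
    unfolding k_def by measurable
  obtain M where M: "M > 0" "\<And>x. \<bar>f x\<bar> \<le> M"
    using test_function_bounded[OF f] by blast
  obtain L where L: "L > 0" "\<And>x y. \<bar>f x - f y\<bar> \<le> L * norm (x - y)"
    using test_function_lipschitz[OF f] by blast
  have K: "?K \<in> lmeasurable"
    using f by (intro lmeasurable_compact) (simp add: test_function_def)
  then have [measurable]: "?K \<in> sets lebesgue" by auto
  have m1: "(\<lambda>z. k (fst z - snd z) * indicator ?K (fst z)) \<in> borel_measurable (lebesgue \<Otimes>\<^sub>M lebesgue)"
    by (intro borel_measurable_times_ennreal measurable_compose[OF pair_diff_measurable] measurable_compose[OF measurable_fst]) measurable
  have m2: "(\<lambda>z. k (fst z - snd z) * indicator ?K (snd z)) \<in> borel_measurable (lebesgue \<Otimes>\<^sub>M lebesgue)"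
    by (intro borel_measurable_times_ennreal measurable_compose[OF pair_diff_measurable] measurable_compose[OF measurable_snd]) measurable
  note [measurable] = test_function_measurable[OF f]
  let ?C = "(2 * M + L) powr p"
  have "energy s p f = (\<integral>\<^sup>+z. ennreal (1 / norm (fst z - snd z) powr (?N + s * p)) * ennreal (\<bar>pair_diff f z\<bar> powr p)
      \<partial>(lebesgue \<Otimes>\<^sub>M lebesgue))"
    unfolding energy_def gagliardo_measure_def by (rule nn_integral_density) measurable
  also have "\<dots> \<le> (\<integral>\<^sup>+z. ennreal ?C * (k (fst z - snd z) * indicator ?K (fst z) + k (fst z - snd z) * indicator ?K (snd z))
      \<partial>(lebesgue \<Otimes>\<^sub>M lebesgue))"
  proof (rule nn_integral_mono)
    fix z :: "'a \<times> 'a"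
    obtain x y where z: "z = (x, y)" by (cases z)
    show "ennreal (1 / norm (fst z - snd z) powr (?N + s * p)) * ennreal (\<bar>pair_diff f z\<bar> powr p)
      \<le> ennreal ?C * (k (fst z - snd z) * indicator ?K (fst z) + k (fst z - snd z) * indicator ?K (snd z))"
    proof (cases "x \<in> ?K \<or> y \<in> ?K")
      case True
      have "\<bar>f x - f y\<bar> \<le> (2 * M + L) * min 1 (norm (x - y))"
      proof (cases "norm (x - y) \<le> 1")
        case True
        have "0 \<le> M * norm (x - y)" using M by simp
        then show ?thesis using L(2)[of x y] True by (simp add: algebra_simps)
      next
        case False
        then show ?thesis using M(2)[of x] M(2)[of y] L(1) by simp
      qed
      then have "\<bar>f x - f y\<bar> powr p \<le> ((2 * M + L) * min 1 (norm (x - y))) powr p"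
        using p by (intro powr_mono2) auto
      also have "\<dots> = ?C * min 1 (norm (x - y)) powr p"
        by (simp add: powr_mult)
      finally have "\<bar>f x - f y\<bar> powr p / norm (x - y) powr (?N + s * p)
          \<le> ?C * min 1 (norm (x - y)) powr p / norm (x - y) powr (?N + s * p)"
        by (intro divide_right_mono) auto
      then have "ennreal (1 / norm (fst z - snd z) powr (?N + s * p)) * ennreal (\<bar>pair_diff f z\<bar> powr p)
          \<le> ennreal ?C * k (x - y)"
        unfolding k_def z pair_diff_def by (simp add: ennreal_leI flip: ennreal_mult)
      also have "\<dots> \<le> ennreal ?C * (k (x - y) * indicator ?K x + k (x - y) * indicator ?K y)"
        using True by (intro mult_left_mono) (auto simp: indicator_def)
      finally show ?thesis by (simp add: z)
    next
      case False
      then have "f x = 0" "f y = 0"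
        using closure_subset[of "{x. f x \<noteq> 0}"] by blast+
      then show ?thesis by (simp add: z pair_diff_def)
    qed
  qed
  also have "\<dots> = ennreal ?C * ((\<integral>\<^sup>+z. k z \<partial>lborel) * emeasure lebesgue ?K + (\<integral>\<^sup>+z. k z \<partial>lborel) * emeasure lebesgue ?K)"
  proof -
    have "k (- z) = k z" for z by (simp add: k_def)
    note slab = nn_integral_kernel_slab[of k ?K, OF _ this]
    show ?thesis
      using m1 m2 by (subst nn_integral_cmult) (simp_all add: nn_integral_add slab)
  qed
  also have "\<dots> < \<infinity>"
    using truncated_kernel_integrable[of "s * p" p, where 'a = 'a] fmeasurableD2[OF K] s p
    unfolding k_def[symmetric]
    by (simp add: ennreal_mult_less_top top.not_eq_extremum)
  finally show ?thesis .
qed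

section \<open>Smooth versions of the positive part and of powers\<close>

text \<open>
  A smooth approximation of the positive part that maps 0 to 0, so that compact supports are
  preserved. The square root is written as a power to make it subject to C_k_powr.
\<close>

definition smooth_pos_part :: "real \<Rightarrow> real \<Rightarrow> real" where
  "smooth_pos_part \<delta> t = (t + (t * t + \<delta> * \<delta>) powr (1 / 2) + (- \<delta>)) * (1 / 2)"

lemma smooth_pos_part_eq: "smooth_pos_part \<delta> t = (t + cmod (Complex t \<delta>) - \<delta>) / 2"
  by (simp add: smooth_pos_part_def cmod_def powr_half_sqrt power2_eq_square)

lemma smooth_pos_part_zero: "0 \<le> \<delta> \<Longrightarrow> smooth_pos_part \<delta> 0 = 0"
  by (simp add: smooth_pos_part_eq cmod_def)

lemma smooth_pos_part_ge: "- \<delta> / 2 \<le> smooth_pos_part \<delta> t"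
  using complex_Re_le_cmod[of "Complex (- t) \<delta>"] by (simp add: smooth_pos_part_eq cmod_def)

lemma smooth_pos_part_lipschitz: "\<bar>smooth_pos_part \<delta> a - smooth_pos_part \<delta> b\<bar> \<le> \<bar>a - b\<bar>"
proof -
  have "\<bar>cmod (Complex a \<delta>) - cmod (Complex b \<delta>)\<bar> \<le> cmod (Complex a \<delta> - Complex b \<delta>)"
    by (rule norm_triangle_ineq3)
  also have "\<dots> = \<bar>a - b\<bar>"
    by (simp add: cmod_def)
  finally have "\<bar>(a - b) + (cmod (Complex a \<delta>) - cmod (Complex b \<delta>))\<bar> \<le> 2 * \<bar>a - b\<bar>"
    by (intro order_trans[OF abs_triangle_ineq]) simp
  moreover have "smooth_pos_part \<delta> a - smooth_pos_part \<delta> b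
      = ((a - b) + (cmod (Complex a \<delta>) - cmod (Complex b \<delta>))) / 2"
    by (simp add: smooth_pos_part_eq field_simps)
  ultimately show ?thesis
    by (simp only: abs_divide abs_numeral divide_le_eq_numeral1 mult.commute)
qed

lemma smooth_pos_part_tendsto:
  assumes "\<delta> \<longlonglongrightarrow> 0" "t \<longlonglongrightarrow> l"
  shows "(\<lambda>n. smooth_pos_part (\<delta> n) (t n)) \<longlonglongrightarrow> max 0 l"
proof -
  have "(\<lambda>n. (t n + sqrt ((t n)\<^sup>2 + (\<delta> n)\<^sup>2) - \<delta> n) / 2) \<longlonglongrightarrow> (l + sqrt (l\<^sup>2 + 0\<^sup>2) - 0) / 2"
    using assms by (intro tendsto_intros) auto
  moreover have "(l + sqrt (l\<^sup>2 + 0\<^sup>2) - 0) / 2 = max 0 l"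
    by (simp add: max_def)
  ultimately show ?thesis
    by (simp add: smooth_pos_part_eq cmod_def)
qed

lemma C_k_smooth_pos_part:
  assumes "C_k k f" "0 < \<delta>"
  shows "C_k k (\<lambda>x. smooth_pos_part \<delta> (f x))"
  unfolding smooth_pos_part_def
  using assms by (intro C_k_mult C_k_add C_k_powr C_k_const) (auto intro: add_nonneg_pos)

text \<open>
  A smooth approximation of |t|^p that maps 0 to 0; the power itself is in general not smooth at
  the origin.
\<close>

definition smooth_abs_powr :: "real \<Rightarrow> real \<Rightarrow> real \<Rightarrow> real" where
  "smooth_abs_powr p \<delta> t = (t * t + \<delta> * \<delta>) powr (p / 2) + - ((\<delta> * \<delta>) powr (p / 2))"

lemma smooth_abs_powr_lipschitz:
  assumes "1 < p" "0 < \<delta>" "\<delta> \<le> 1" "\<bar>a\<bar> \<le> M" "\<bar>b\<bar> \<le> M"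
  shows "\<bar>smooth_abs_powr p \<delta> a - smooth_abs_powr p \<delta> b\<bar>
    \<le> p * (M * M + 1) powr ((p - 1) / 2) * \<bar>a - b\<bar>"
proof -
  \<comment> \<open>The factor |t| is at most (t^2 + \<delta>^2)^(1/2), which keeps the derivative bounded as \<delta> tends to 0 even for p < 2.\<close>
  let ?D = "\<lambda>t. 2 * t * ((p / 2) * (t * t + \<delta> * \<delta>) powr (p / 2 - 1))"
  have pos: "0 < t * t + \<delta> * \<delta>" for t
    using assms by (intro add_nonneg_pos) auto
  have deriv: "(smooth_abs_powr p \<delta> has_field_derivative ?D t) (at t within S)" for t S
  proof -
    have "((\<lambda>t. (t * t + \<delta> * \<delta>) powr (p / 2)) has_field_derivative
        (p / 2) * (t * t + \<delta> * \<delta>) powr (p / 2 - 1) * (t + t)) (at t)"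
      by (rule DERIV_chain2[where g = "\<lambda>t. t * t + \<delta> * \<delta>" and x = t, OF has_real_derivative_powr[OF pos]]) (auto intro!: derivative_eq_intros)
    from has_field_derivative_at_within[OF DERIV_add[OF this DERIV_const[of "- ((\<delta> * \<delta>) powr (p / 2))"]], of S]
    show ?thesis
      unfolding smooth_abs_powr_def[abs_def] by (rule DERIV_cong) (simp add: algebra_simps)
  qed
  have bound: "norm (?D t) \<le> p * (M * M + 1) powr ((p - 1) / 2)" if "t \<in> {- M..M}" for t
  proof -
    have "\<bar>t\<bar> = sqrt (t * t)" by simp
    also have "\<dots> \<le> (t * t + \<delta> * \<delta>) powr (1 / 2)"
      unfolding powr_half_sqrt[OF less_imp_le[OF pos]] by (rule real_sqrt_le_mono) simp
    finally have "p * (\<bar>t\<bar> * (t * t + \<delta> * \<delta>) powr (p / 2 - 1))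
        \<le> p * ((t * t + \<delta> * \<delta>) powr (1 / 2) * (t * t + \<delta> * \<delta>) powr (p / 2 - 1))"
      using assms by (intro mult_left_mono mult_right_mono) auto
    also have "\<dots> = p * (t * t + \<delta> * \<delta>) powr ((p - 1) / 2)"
      by (simp add: powr_add[symmetric] diff_divide_distrib)
    also have "\<dots> \<le> p * (M * M + 1) powr ((p - 1) / 2)"
    proof -
      have "\<delta> * \<delta> \<le> 1 * 1" using assms by (intro mult_mono) auto
      moreover have "\<bar>t\<bar> * \<bar>t\<bar> \<le> M * M" using that by (intro mult_mono) auto
      ultimately show ?thesis
        using assms pos[of t] by (intro mult_left_mono powr_mono2) auto
    qed
    finally show ?thesis
      using assms by (simp add: abs_mult mult_ac)
  qed
  have "norm (smooth_abs_powr p \<delta> a - smooth_abs_powr p \<delta> b)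
      \<le> p * (M * M + 1) powr ((p - 1) / 2) * norm (a - b)"
    by (rule field_differentiable_bound[OF convex_real_interval(5) deriv bound]) (use assms in auto)
  then show ?thesis by simp
qed

lemma powr_lipschitz_away_from_zero:
  fixes a b c r :: real
  assumes "0 < c" "c \<le> a" "c \<le> b" "r \<le> 1"
  shows "\<bar>a powr r - b powr r\<bar> \<le> \<bar>r\<bar> * c powr (r - 1) * \<bar>a - b\<bar>"
proof -
  have "norm (a powr r - b powr r) \<le> \<bar>r\<bar> * c powr (r - 1) * norm (a - b)"
  proof (rule field_differentiable_bound[of "{c..}" "\<lambda>t. t powr r" "\<lambda>t. r * t powr (r - 1)"])
    show "((\<lambda>t. t powr r) has_field_derivative r * t powr (r - 1)) (at t within {c..})" if "t \<in> {c..}" for t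
      by (rule has_field_derivative_at_within[OF has_real_derivative_powr]) (use that assms in auto)
    show "norm (r * t powr (r - 1)) \<le> \<bar>r\<bar> * c powr (r - 1)" if "t \<in> {c..}" for t
      using that assms by (auto simp: abs_mult intro!: mult_left_mono powr_mono2')
  qed (use assms in auto)
  then show ?thesis by simp
qed

section \<open>Lipschitz operations on the Sobolev space\<close>

locale fractional_sobolev =
  fixes s p :: real and \<Omega> :: "'a::euclidean_space set"
  assumes s: "0 < s" "s < 1" and p: "1 < p"
    and measurable_domain [measurable]: "\<Omega> \<in> sets lebesgue" and bounded_domain: "bounded \<Omega>"
begin

text \<open>
  Convergence almost everywhere is recorded together with convergence in the norm, because it
  identifies the limits of nonlinear expressions in f n.
\<close>

definition approximates :: "(nat \<Rightarrow> 'a \<Rightarrow> real) \<Rightarrow> ('a \<Rightarrow> real) \<Rightarrow> bool" where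
  "approximates f u \<longleftrightarrow> u \<in> borel_measurable lebesgue \<and> (\<forall>n. test_function \<Omega> (f n)) \<and>
     (\<lambda>n. energy s p (\<lambda>x. u x - f n x)) \<longlonglongrightarrow> 0 \<and> (\<lambda>n. mass p (\<lambda>x. u x - f n x)) \<longlonglongrightarrow> 0 \<and>
     (AE x in lebesgue. (\<lambda>n. f n x) \<longlonglongrightarrow> u x)"

lemma approximatesD:
  assumes "approximates f u"
  shows "u \<in> borel_measurable lebesgue" "test_function \<Omega> (f n)"
    "(\<lambda>n. energy s p (\<lambda>x. u x - f n x)) \<longlonglongrightarrow> 0" "(\<lambda>n. mass p (\<lambda>x. u x - f n x)) \<longlonglongrightarrow> 0"
    "AE x in lebesgue. (\<lambda>n. f n x) \<longlonglongrightarrow> u x"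
  using assms by (auto simp: approximates_def)

lemma approximates_exists:
  assumes "u \<in> W0 s p \<Omega>"
  obtains f where "approximates f u"
proof (rule W0E[OF _ measurable_domain assms])
  show "0 < p" using p by simp
next
  fix f
  assume "\<And>n. test_function \<Omega> (f n)" "(\<lambda>n. energy s p (\<lambda>x. u x - f n x)) \<longlonglongrightarrow> 0"
    "(\<lambda>n. mass p (\<lambda>x. u x - f n x)) \<longlonglongrightarrow> 0" "AE x in lebesgue. (\<lambda>n. f n x) \<longlonglongrightarrow> u x"
  then show thesis
    using W0_measurable[OF assms] by (intro that[of f]) (simp add: approximates_def)
qed

lemma approximates_const:
  assumes "test_function \<Omega> f"
  shows "approximates (\<lambda>n. f) f"
  using assms test_function_measurable p by (auto simp: approximates_def energy_def mass_def pair_diff_def)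

lemma approximates_finite:
  assumes "approximates f u"
  shows "energy s p u < \<infinity>" "mass p u < \<infinity>"
proof -
  note [measurable] = approximatesD(1)[OF assms] test_function_measurable[OF approximatesD(2)[OF assms]]
  have "\<forall>\<^sub>F n in sequentially. energy s p (\<lambda>x. u x - f n x) < \<infinity> \<and> mass p (\<lambda>x. u x - f n x) < \<infinity>"
    using order_tendstoD(2)[OF approximatesD(3)[OF assms], of \<infinity>]
      order_tendstoD(2)[OF approximatesD(4)[OF assms], of \<infinity>]
    by (intro eventually_conj) auto
  then obtain n where n: "energy s p (\<lambda>x. u x - f n x) < \<infinity>" "mass p (\<lambda>x. u x - f n x) < \<infinity>"
    using eventually_happens'[OF sequentially_bot] by blast
  have diff: "pair_diff (\<lambda>x. u x - f n x) z = pair_diff u z - pair_diff (f n) z" for z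
    by (simp add: pair_diff_def)
  have test: "test_function \<Omega> (f n)" by (rule approximatesD(2)[OF assms])
  have "0 < p" using p by simp
  show "energy s p u < \<infinity>"
    unfolding energy_def
  proof (rule lp_norm_finite_of_diff)
    show "(\<integral>\<^sup>+z. ennreal (\<bar>pair_diff u z - pair_diff (f n) z\<bar> powr p) \<partial>gagliardo_measure (s * p)) < \<infinity>"
      using n(1) by (simp only: energy_def diff)
    show "(\<integral>\<^sup>+z. ennreal (\<bar>pair_diff (f n) z\<bar> powr p) \<partial>gagliardo_measure (s * p)) < \<infinity>"
      using energy_test_function_finite[OF test s \<open>0 < p\<close>] by (simp only: energy_def)
  qed (use p in simp_all)
  show "mass p u < \<infinity>"
    unfolding mass_def
  proof (rule lp_norm_finite_of_diff)
    show "(\<integral>\<^sup>+x. ennreal (\<bar>u x - f n x\<bar> powr p) \<partial>lebesgue) < \<infinity>"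
      using n(2) by (simp only: mass_def)
    show "(\<integral>\<^sup>+x. ennreal (\<bar>f n x\<bar> powr p) \<partial>lebesgue) < \<infinity>"
      using mass_test_function_finite[OF test \<open>0 < p\<close>] by (simp only: mass_def)
  qed (use p in simp_all)
qed

lemma W0_finite:
  assumes "u \<in> W0 s p \<Omega>"
  shows "energy s p u < \<infinity>" "mass p u < \<infinity>"
  using approximates_exists[OF assms] approximates_finite by metis+

text \<open>
  The principle behind every membership in W0 below. If h n is obtained from f n and g n by smooth
  operations with a Lipschitz constant that does not depend on n, then h n converges in the norm of
  W0 to its pointwise limit.
\<close>

lemma W0_of_dominated_limit:
  assumes f: "approximates f u" and g: "approximates g w" and C: "0 \<le> C"
    and v [measurable]: "v \<in> borel_measurable lebesgue"
    and h: "\<And>n. test_function \<Omega> (h n)"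
    and bound_diff: "\<And>n x y. \<bar>h n x - h n y\<bar> \<le> C * (\<bar>f n x - f n y\<bar> + \<bar>g n x - g n y\<bar>)"
    and bound: "\<And>n x. \<bar>h n x\<bar> \<le> C * (\<bar>f n x\<bar> + \<bar>g n x\<bar>)"
    and lim: "AE x in lebesgue. (\<lambda>n. h n x) \<longlonglongrightarrow> v x"
  shows "v \<in> W0 s p \<Omega>"
proof (rule W0I[OF _ measurable_domain v _ h])
  note [measurable] = approximatesD(1)[OF f] approximatesD(1)[OF g] test_function_measurable[OF approximatesD(2)[OF f]]
    test_function_measurable[OF approximatesD(2)[OF g]] test_function_measurable[OF h]
  have diff: "pair_diff (\<lambda>x. a x - b x) z = pair_diff a z - pair_diff b z" for a b :: "'a \<Rightarrow> real" and z
    by (simp add: pair_diff_def)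
  have pairs: "AE z in gagliardo_measure (s * p). (\<lambda>n. pair_diff (a n) z) \<longlonglongrightarrow> pair_diff b z"
    if "AE x in lebesgue. (\<lambda>n. a n x) \<longlonglongrightarrow> b x" for a :: "nat \<Rightarrow> 'a \<Rightarrow> real" and b
    using AE_gagliardo_measure_pair[OF that] by eventually_elim (auto simp: pair_diff_def intro: tendsto_diff)
  show "0 < p" using p by simp
  show "AE x in lebesgue. x \<notin> \<Omega> \<longrightarrow> v x = 0"
    using lim
  proof eventually_elim
    case (elim x)
    then show ?case
      using test_function_zero_outside[OF h] LIMSEQ_unique[OF elim] by auto
  qed
  show "(\<lambda>n. energy s p (\<lambda>x. v x - h n x)) \<longlonglongrightarrow> 0"
    unfolding energy_def diff
  proof (rule lp_convergence_of_domination[where F = "\<lambda>n. pair_diff (f n)" and Fl = "pair_diff u"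
        and H = "\<lambda>n. pair_diff (g n)" and Hl = "pair_diff w" and C = C])
    show "\<bar>pair_diff (h n) z\<bar> \<le> C * (\<bar>pair_diff (f n) z\<bar> + \<bar>pair_diff (g n) z\<bar>)" for n z
      using bound_diff by (simp add: pair_diff_def)
  qed (use p C approximatesD(3)[OF f] approximatesD(3)[OF g] approximates_finite(1)[OF f] approximates_finite(1)[OF g]
      pairs[OF approximatesD(5)[OF f]] pairs[OF approximatesD(5)[OF g]] pairs[OF lim]
    in \<open>simp_all add: energy_def diff\<close>)
  show "(\<lambda>n. mass p (\<lambda>x. v x - h n x)) \<longlonglongrightarrow> 0"
    unfolding mass_def
    by (rule lp_convergence_of_domination[where F = f and Fl = u and H = g and Hl = w and C = C])
      (use p C approximatesD(4)[OF f] approximatesD(4)[OF g] approximates_finite(2)[OF f] approximates_finite(2)[OF g]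
        approximatesD(5)[OF f] approximatesD(5)[OF g] lim bound in \<open>simp_all add: mass_def\<close>)
qed

lemma W0_scale:
  assumes "u \<in> W0 s p \<Omega>"
  shows "(\<lambda>x. c * u x) \<in> W0 s p \<Omega>"
proof -
  obtain f where f: "approximates f u"
    using approximates_exists[OF assms] .
  note [measurable] = W0_measurable[OF assms]
  show ?thesis
  proof (rule W0_of_dominated_limit[OF f f, where h = "\<lambda>n x. c * f n x" and C = "\<bar>c\<bar>"])
    show "test_function \<Omega> (\<lambda>x. c * f n x)" for n
      using approximatesD(2)[OF f, of n]
      by (intro test_function_combine[OF approximatesD(2)[OF f, of n] approximatesD(2)[OF f, of n]] C_k_mult C_k_const)
        (auto simp: test_function_def)
    show "AE x in lebesgue. (\<lambda>n. c * f n x) \<longlonglongrightarrow> c * u x"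
      using approximatesD(5)[OF f] by eventually_elim (rule tendsto_mult_left)
    show "\<bar>c * f n x - c * f n y\<bar> \<le> \<bar>c\<bar> * (\<bar>f n x - f n y\<bar> + \<bar>f n x - f n y\<bar>)" for n x y
      by (auto simp: abs_mult intro!: mult_left_mono simp flip: right_diff_distrib)
    show "\<bar>c * f n x\<bar> \<le> \<bar>c\<bar> * (\<bar>f n x\<bar> + \<bar>f n x\<bar>)" for n x
      by (auto simp: abs_mult intro!: mult_left_mono)
  qed auto
qed

lemma W0_pos_part_diff:
  assumes u: "u \<in> W0 s p \<Omega>" and w: "w \<in> W0 s p \<Omega>"
  shows "(\<lambda>x. max 0 (u x - w x)) \<in> W0 s p \<Omega>"
proof -
  obtain f g where f: "approximates f u" and g: "approximates g w"
    using approximates_exists[OF u] approximates_exists[OF w] by metis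
  note [measurable] = W0_measurable[OF u] W0_measurable[OF w]
  define \<delta> where "\<delta> n = 1 / real (Suc n)" for n
  have \<delta>: "0 < \<delta> n" "\<delta> \<longlonglongrightarrow> 0" for n
    unfolding \<delta>_def using LIMSEQ_inverse_real_of_nat by (auto simp: inverse_eq_divide)
  let ?h = "\<lambda>n x. smooth_pos_part (\<delta> n) (f n x - g n x)"
  show ?thesis
  proof (rule W0_of_dominated_limit[OF f g, where h = ?h and C = 1])
    show "test_function \<Omega> (?h n)" for n
      using approximatesD(2)[OF f, of n] approximatesD(2)[OF g, of n] \<delta>(1)[of n]
      by (intro test_function_combine[OF approximatesD(2)[OF f, of n] approximatesD(2)[OF g, of n]]
          C_k_smooth_pos_part C_k_diff)
        (auto simp: test_function_def smooth_pos_part_zero)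
    show "AE x in lebesgue. (\<lambda>n. ?h n x) \<longlonglongrightarrow> max 0 (u x - w x)"
      using approximatesD(5)[OF f] approximatesD(5)[OF g]
      by eventually_elim (intro smooth_pos_part_tendsto \<delta> tendsto_diff)
    show "\<bar>?h n x - ?h n y\<bar> \<le> 1 * (\<bar>f n x - f n y\<bar> + \<bar>g n x - g n y\<bar>)" for n x y
      using smooth_pos_part_lipschitz[of "\<delta> n" "f n x - g n x" "f n y - g n y"] by simp
    show "\<bar>?h n x\<bar> \<le> 1 * (\<bar>f n x\<bar> + \<bar>g n x\<bar>)" for n x
      using smooth_pos_part_lipschitz[of "\<delta> n" "f n x - g n x" 0] \<delta>(1)[of n] by (simp add: smooth_pos_part_zero)
  qed auto
qed

section \<open>Energy pairing and comparison principle\<close>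

lemma integrable_pairing:
  assumes "u \<in> W0 s p \<Omega>" "v \<in> W0 s p \<Omega>"
  shows "integrable (gagliardo_measure (s * p)) (\<lambda>z. signed_power p (pair_diff u z) * pair_diff v z)"
proof (rule Bochner_Integration.integrable_bound)
  note [measurable] = W0_measurable[OF assms(1)] W0_measurable[OF assms(2)]
  have "integrable (gagliardo_measure (s * p)) (\<lambda>z. \<bar>pair_diff a z\<bar> powr p)" if "a \<in> W0 s p \<Omega>" for a
    using W0_finite(1)[OF that] W0_measurable[OF that]
    by (intro integrableI_nonneg) (auto simp: energy_def)
  then show "integrable (gagliardo_measure (s * p)) (\<lambda>z. \<bar>pair_diff u z\<bar> powr p + \<bar>pair_diff v z\<bar> powr p)"
    using assms by auto
  show "(\<lambda>z. signed_power p (pair_diff u z) * pair_diff v z) \<in> borel_measurable (gagliardo_measure (s * p))"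
    by measurable
  show "AE z in gagliardo_measure (s * p). norm (signed_power p (pair_diff u z) * pair_diff v z)
      \<le> norm (\<bar>pair_diff u z\<bar> powr p + \<bar>pair_diff v z\<bar> powr p)"
    using signed_power_mult_le[OF p] by (intro AE_I2) auto
qed

lemma energy_eq_pairing:
  assumes "u \<in> W0 s p \<Omega>"
  shows "energy s p u = ennreal (frac_plap s p u u)" and "0 \<le> frac_plap s p u u"
proof -
  note [measurable] = W0_measurable[OF assms]
  show "energy s p u = ennreal (frac_plap s p u u)"
    using integrable_pairing[OF assms assms]
    by (simp add: frac_plap_eq energy_def signed_power_self nn_integral_eq_integral)
  show "0 \<le> frac_plap s p u u"
    by (simp add: frac_plap_eq signed_power_self)
qed

lemma complement_not_null: "\<not> (AE x in lebesgue. x \<in> \<Omega>)"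
proof
  assume "AE x in lebesgue. x \<in> \<Omega>"
  then have "emeasure lebesgue (UNIV :: 'a set) = emeasure lebesgue \<Omega>"
    by (intro emeasure_eq_AE) (auto elim: eventually_mono)
  moreover have "\<Omega> \<in> lmeasurable"
    using bounded_domain by (intro bounded_set_imp_lmeasurable) auto
  ultimately show False
    using fmeasurableD2[of \<Omega> lebesgue] by (simp add: emeasure_completion)
qed

text \<open>
  A function with vanishing differences is constant almost everywhere, and the constant is 0 because
  the complement of a bounded set has positive measure. The diagonal, where the density vanishes,
  causes no loss, since differences are 0 there.
\<close>

lemma AE_zero_of_AE_pair_diff_zero:
  assumes [measurable]: "v \<in> borel_measurable lebesgue" and zero: "AE x in lebesgue. x \<notin> \<Omega> \<longrightarrow> v x = 0"
    and diff: "AE z in gagliardo_measure q. pair_diff v z = 0"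
  shows "AE x in lebesgue. v x = 0"
proof -
  interpret pair_sigma_finite "lebesgue :: 'a measure" "lebesgue :: 'a measure"
    by (rule pair_sigma_finite_lebesgue)
  have "AE z in lebesgue \<Otimes>\<^sub>M (lebesgue :: 'a measure).
      0 < ennreal (1 / norm (fst z - snd z) powr (real DIM('a) + q)) \<longrightarrow> pair_diff v z = 0"
    using diff unfolding gagliardo_measure_def by (subst (asm) AE_density) auto
  then have "AE z in lebesgue \<Otimes>\<^sub>M (lebesgue :: 'a measure). pair_diff v z = 0"
  proof eventually_elim
    case (elim z)
    then show ?case by (cases "fst z = snd z") (auto simp: pair_diff_def)
  qed
  from AE_pair[OF this] show ?thesis
  proof eventually_elim
    case (elim x)
    show ?case
    proof (rule ccontr)
      assume "v x \<noteq> 0"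
      have "AE y in lebesgue. y \<in> \<Omega>"
        using elim zero by eventually_elim (use \<open>v x \<noteq> 0\<close> in \<open>auto simp: pair_diff_def\<close>)
      then show False using complement_not_null by contradiction
    qed
  qed
qed

text \<open>
  Let v be the positive part of u - w. The difference of v between two points is zero or has the
  same sign as the difference of u minus that of w. As the signed power is increasing, the
  integrand of the difference of the two pairings is nonnegative, whereas its integral is at most 0
  by assumption. So the integrand vanishes almost everywhere, and strict monotonicity forces the
  differences of v to vanish.
\<close>

theorem comparison_principle:
  assumes u: "u \<in> W0 s p \<Omega>" and w: "w \<in> W0 s p \<Omega>"
    and le: "frac_plap s p u (\<lambda>x. max 0 (u x - w x)) \<le> frac_plap s p w (\<lambda>x. max 0 (u x - w x))"
  shows "AE x in lebesgue. u x \<le> w x"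
proof -
  define v where "v x = max 0 (u x - w x)" for x
  have v: "v \<in> W0 s p \<Omega>"
    unfolding v_def by (rule W0_pos_part_diff[OF u w])
  note [measurable] = W0_measurable[OF u] W0_measurable[OF w] W0_measurable[OF v]
  let ?F = "\<lambda>z. (signed_power p (pair_diff u z) - signed_power p (pair_diff w z)) * pair_diff v z"
  have F_sign: "0 \<le> ?F z \<and> (?F z = 0 \<longrightarrow> pair_diff v z = 0)" for z
  proof -
    have v_diff: "pair_diff v z = max 0 (u (fst z) - w (fst z)) - max 0 (u (snd z) - w (snd z))"
      by (simp add: pair_diff_def v_def)
    consider "pair_diff v z = 0" | "pair_diff v z > 0" | "pair_diff v z < 0" by linarith
    then show ?thesis
    proof cases
      case 2
      then have "pair_diff w z < pair_diff u z"
        unfolding v_diff by (auto simp: pair_diff_def max_def split: if_splits)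
      then have "0 < ?F z"
        using 2 signed_power_strict_mono[OF p] by (intro mult_pos_pos) auto
      then show ?thesis by linarith
    next
      case 3
      then have "pair_diff u z < pair_diff w z"
        unfolding v_diff by (auto simp: pair_diff_def max_def split: if_splits)
      then have "0 < ?F z"
        using 3 signed_power_strict_mono[OF p] by (intro mult_neg_neg) auto
      then show ?thesis by linarith
    qed simp
  qed
  have F_eq: "?F z = signed_power p (pair_diff u z) * pair_diff v z - signed_power p (pair_diff w z) * pair_diff v z" for z
    by (simp add: algebra_simps)
  have int: "integrable (gagliardo_measure (s * p)) ?F"
    unfolding F_eq using integrable_pairing[OF u v] integrable_pairing[OF w v] by simp
  have "(\<integral>z. ?F z \<partial>gagliardo_measure (s * p)) = frac_plap s p u v - frac_plap s p w v"
    unfolding F_eq using integrable_pairing[OF u v] integrable_pairing[OF w v] by (simp add: frac_plap_eq)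
  also have "\<dots> \<le> 0"
    using le by (simp add: v_def[abs_def])
  finally have "(\<integral>z. ?F z \<partial>gagliardo_measure (s * p)) = 0"
    using F_sign by (intro antisym integral_nonneg_AE) auto
  then have "AE z in gagliardo_measure (s * p). ?F z = 0"
    using integral_nonneg_eq_0_iff_AE[OF int] F_sign by simp
  then have "AE z in gagliardo_measure (s * p). pair_diff v z = 0"
    using F_sign by (auto elim: eventually_mono)
  from AE_zero_of_AE_pair_diff_zero[OF _ W0_zero_outside[OF v] this]
  have "AE x in lebesgue. v x = 0" by simp
  then show ?thesis
    by eventually_elim (simp add: v_def max_def split: if_splits)
qed

lemma frac_plap_scale:
  assumes "0 \<le> c" and [measurable]: "u \<in> borel_measurable lebesgue" "v \<in> borel_measurable lebesgue"
  shows "frac_plap s p (\<lambda>x. c * u x) v = c powr (p - 1) * frac_plap s p u v"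
proof -
  have "pair_diff (\<lambda>x. c * u x) z = c * pair_diff u z" for z
    by (simp add: pair_diff_def algebra_simps)
  then show ?thesis
    using assms(1) by (simp add: frac_plap_eq signed_power_scale mult.assoc)
qed

section \<open>Picone inequality and Rayleigh quotients\<close>

lemma test_function_in_W0:
  assumes "test_function \<Omega> f"
  shows "f \<in> W0 s p \<Omega>"
  using approximates_const[OF assms] test_function_zero_outside[OF assms] p
  by (intro W0I[where f = "\<lambda>n. f"]) (auto simp: approximates_def)

lemma mass_eq_integral:
  assumes "u \<in> W0 s p \<Omega>"
  shows "integrable (lebesgue_on \<Omega>) (\<lambda>x. \<bar>u x\<bar> powr p)"
    and "mass p u = ennreal (\<integral>x. \<bar>u x\<bar> powr p \<partial>lebesgue_on \<Omega>)"
proof -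
  have [measurable]: "u \<in> borel_measurable (lebesgue_on \<Omega>)"
    using W0_measurable[OF assms] by (rule measurable_restrict_space1)
  have eq: "mass p u = (\<integral>\<^sup>+x. ennreal (\<bar>u x\<bar> powr p) \<partial>lebesgue_on \<Omega>)"
    unfolding mass_def using W0_zero_outside[OF assms]
    by (subst nn_integral_restrict_space) (auto intro!: nn_integral_cong_AE elim!: eventually_mono simp: indicator_def)
  show int: "integrable (lebesgue_on \<Omega>) (\<lambda>x. \<bar>u x\<bar> powr p)"
    using W0_finite(2)[OF assms] by (intro integrableI_nonneg) (auto simp: eq)
  show "mass p u = ennreal (\<integral>x. \<bar>u x\<bar> powr p \<partial>lebesgue_on \<Omega>)"
    unfolding eq by (rule nn_integral_eq_integral[OF int]) auto
qed

lemma lmeasurable_domain: "\<Omega> \<in> lmeasurable"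
  using bounded_domain by (intro bounded_set_imp_lmeasurable) auto

lemma W0_integrable:
  assumes "u \<in> W0 s p \<Omega>"
  shows "integrable (lebesgue_on \<Omega>) u"
proof (rule Bochner_Integration.integrable_bound)
  interpret finite_measure "lebesgue_on \<Omega>"
    by (rule finite_measure_lebesgue_on[OF lmeasurable_domain])
  show "integrable (lebesgue_on \<Omega>) (\<lambda>x. 1 + \<bar>u x\<bar> powr p)"
    using mass_eq_integral(1)[OF assms] by simp
  show "u \<in> borel_measurable (lebesgue_on \<Omega>)"
    using W0_measurable[OF assms] by (rule measurable_restrict_space1)
  have "t \<le> 1 + t powr p" if "0 \<le> t" for t :: real
  proof (cases "t \<le> 1")
    case False
    then have "t powr 1 \<le> t powr p" using p by (intro powr_mono) auto
    then show ?thesis using False by simp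
  qed (use that in \<open>simp add: add_increasing2\<close>)
  then show "AE x in lebesgue_on \<Omega>. norm (u x) \<le> norm (1 + \<bar>u x\<bar> powr p)"
    by (intro AE_I2) simp
qed

text \<open>
  Since f is bounded and \<epsilon> keeps the denominator away from 0, the quotient is a Lipschitz expression
  in f and e. Its smooth versions use the approximants of e in place of e.
\<close>

lemma picone_quotient_in_W0:
  assumes e: "e \<in> W0 s p \<Omega>" and f: "test_function \<Omega> f" and \<epsilon>: "0 < \<epsilon>" "\<epsilon> \<le> 1"
  shows "(\<lambda>x. \<bar>f x\<bar> powr p * (max 0 (e x) + \<epsilon>) powr (1 - p)) \<in> W0 s p \<Omega>"
proof -
  obtain g where g: "approximates g e"
    using approximates_exists[OF e] .
  obtain M where M: "0 < M" "\<And>x. \<bar>f x\<bar> \<le> M"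
    using test_function_bounded[OF f] by blast
  note [measurable] = W0_measurable[OF e] test_function_measurable[OF f]
  \<comment> \<open>The bound \<delta> n \<le> \<epsilon> matters: the smooth positive part is at least - \<delta> n / 2, so q n stays above \<epsilon> / 2.\<close>
  define \<delta> where "\<delta> n = \<epsilon> / real (Suc n)" for n
  have \<delta>: "0 < \<delta> n" "\<delta> n \<le> \<epsilon>" "\<delta> n \<le> 1" for n
    using \<epsilon> by (auto simp: \<delta>_def divide_le_eq add_increasing)
  have \<delta>_lim: "\<delta> \<longlonglongrightarrow> 0"
    unfolding \<delta>_def using LIMSEQ_inverse_real_of_nat tendsto_mult_left[of _ 0 sequentially \<epsilon>]
    by (fastforce simp: divide_inverse)
  define A where "A n x = smooth_abs_powr p (\<delta> n) (f x)" for n x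
  define q where "q n x = smooth_pos_part (\<delta> n) (g n x) + \<epsilon>" for n x
  define C where "C = p * (M * M + 1) powr ((p - 1) / 2)"
  define b where "b = (\<epsilon> / 2) powr (1 - p)"
  define b' where "b' = \<bar>1 - p\<bar> * (\<epsilon> / 2) powr (1 - p - 1)"
  have nonneg: "0 \<le> C" "0 \<le> b" "0 \<le> b'"
    using p by (auto simp: C_def b_def b'_def)
  have q_ge: "\<epsilon> / 2 \<le> q n x" for n x
    using smooth_pos_part_ge[of "\<delta> n" "g n x"] \<delta>(2)[of n] by (simp add: q_def)
  then have q_pos: "0 < q n x" for n x
    using \<epsilon> by (meson half_gt_zero less_le_trans)
  have A_diff: "\<bar>A n x - A n y\<bar> \<le> C * \<bar>f x - f y\<bar>" for n x y
    unfolding A_def C_def using p \<delta> M by (intro smooth_abs_powr_lipschitz) auto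
  have A_le: "\<bar>A n x\<bar> \<le> C * \<bar>f x\<bar>" for n x
    using smooth_abs_powr_lipschitz[of p "\<delta> n" "f x" M 0] p \<delta> M
    by (simp add: A_def C_def smooth_abs_powr_def less_imp_le)
  have B_le: "q n x powr (1 - p) \<le> b" for n x
    unfolding b_def using q_ge p \<epsilon> by (intro powr_mono2') auto
  have B_diff: "\<bar>q n x powr (1 - p) - q n y powr (1 - p)\<bar> \<le> b' * \<bar>g n x - g n y\<bar>" for n x y
  proof -
    have "\<bar>q n x powr (1 - p) - q n y powr (1 - p)\<bar> \<le> b' * \<bar>q n x - q n y\<bar>"
      unfolding b'_def using q_ge p \<epsilon> by (intro powr_lipschitz_away_from_zero) auto
    also have "\<dots> \<le> b' * \<bar>g n x - g n y\<bar>"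
      using smooth_pos_part_lipschitz nonneg by (intro mult_left_mono) (auto simp: q_def)
    finally show ?thesis .
  qed
  let ?h = "\<lambda>n x. A n x * q n x powr (1 - p)"
  let ?C = "C * b + C * M * b'"
  show ?thesis
  proof (rule W0_of_dominated_limit[OF approximates_const[OF f] g, where h = ?h and C = ?C])
    show "0 \<le> ?C" using nonneg M by simp
    show "test_function \<Omega> (?h n)" for n
    proof (rule test_function_combine[OF f f])
      have f_smooth: "C_k k f" and g_smooth: "C_k k (g n)" for k
        using f approximatesD(2)[OF g, of n] by (simp_all add: test_function_def)
      have "0 < f x * f x + \<delta> n * \<delta> n" for x
        using \<delta>(1)[of n] by (intro add_nonneg_pos) auto
      then have "C_k k (A n)" for k
        unfolding A_def[abs_def] smooth_abs_powr_def
        by (intro C_k_add C_k_powr C_k_mult f_smooth C_k_const)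
      moreover have "C_k k (q n)" for k
        unfolding q_def[abs_def] by (intro C_k_add C_k_smooth_pos_part C_k_const g_smooth \<delta>)
      ultimately show "C_k k (?h n)" for k
        by (intro C_k_mult C_k_powr q_pos)
      show "?h n x = 0" if "f x = 0" for x
        using that by (simp add: A_def smooth_abs_powr_def)
    qed
    show "\<bar>?h n x - ?h n y\<bar> \<le> ?C * (\<bar>f x - f y\<bar> + \<bar>g n x - g n y\<bar>)" for n x y
    proof -
      have "?h n x - ?h n y = (A n x - A n y) * q n x powr (1 - p)
          + A n y * (q n x powr (1 - p) - q n y powr (1 - p))"
        by (simp add: algebra_simps)
      then have "\<bar>?h n x - ?h n y\<bar> \<le> \<bar>A n x - A n y\<bar> * \<bar>q n x powr (1 - p)\<bar>
          + \<bar>A n y\<bar> * \<bar>q n x powr (1 - p) - q n y powr (1 - p)\<bar>"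
        by (metis abs_triangle_ineq abs_mult)
      also have "\<dots> \<le> C * \<bar>f x - f y\<bar> * b + C * M * (b' * \<bar>g n x - g n y\<bar>)"
      proof -
        have "\<bar>A n y\<bar> \<le> C * M"
          by (rule order_trans[OF A_le mult_left_mono[OF M(2) nonneg(1)]])
        then show ?thesis
          using A_diff B_le B_diff nonneg M by (intro add_mono mult_mono) auto
      qed
      also have "\<dots> \<le> ?C * (\<bar>f x - f y\<bar> + \<bar>g n x - g n y\<bar>)"
      proof -
        have "0 \<le> C * b * \<bar>g n x - g n y\<bar>" "0 \<le> C * M * b' * \<bar>f x - f y\<bar>"
          using nonneg M by auto
        then show ?thesis by (simp add: algebra_simps)
      qed
      finally show ?thesis .
    qed
    show "\<bar>?h n x\<bar> \<le> ?C * (\<bar>f x\<bar> + \<bar>g n x\<bar>)" for n x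
    proof -
      have "\<bar>?h n x\<bar> \<le> C * \<bar>f x\<bar> * b"
        unfolding abs_mult using A_le B_le nonneg by (intro mult_mono) auto
      also have "\<dots> \<le> ?C * (\<bar>f x\<bar> + \<bar>g n x\<bar>)"
      proof -
        have "0 \<le> C * b * \<bar>g n x\<bar>" "0 \<le> C * M * b' * \<bar>f x\<bar>" "0 \<le> C * M * b' * \<bar>g n x\<bar>"
          using nonneg M by auto
        then show ?thesis by (simp add: algebra_simps)
      qed
      finally show ?thesis .
    qed
    show "AE x in lebesgue. (\<lambda>n. ?h n x) \<longlonglongrightarrow> \<bar>f x\<bar> powr p * (max 0 (e x) + \<epsilon>) powr (1 - p)"
      using approximatesD(5)[OF g]
    proof eventually_elim
      case (elim x)
      have "(\<lambda>n. A n x) \<longlonglongrightarrow> (f x * f x + 0 * 0) powr (p / 2) + - ((0 * 0) powr (p / 2))"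
        unfolding A_def smooth_abs_powr_def using \<delta>_lim p
        by (intro tendsto_add tendsto_minus tendsto_powr' tendsto_mult tendsto_const) auto
      moreover have "(f x * f x) powr (p / 2) = \<bar>f x\<bar> powr p"
      proof -
        have "f x * f x = \<bar>f x\<bar> powr 2" by (simp add: power2_eq_square)
        then show ?thesis by (simp only: powr_powr) simp
      qed
      moreover have "(\<lambda>n. q n x) \<longlonglongrightarrow> max 0 (e x) + \<epsilon>"
        unfolding q_def by (intro tendsto_add smooth_pos_part_tendsto \<delta>_lim elim tendsto_const)
      then have "(\<lambda>n. q n x powr (1 - p)) \<longlonglongrightarrow> (max 0 (e x) + \<epsilon>) powr (1 - p)"
        using \<epsilon> by (intro tendsto_powr tendsto_const) auto
      ultimately show ?case
        by (intro tendsto_mult) simp_all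
    qed
  qed measurable
qed

text \<open>
  The discrete Picone inequality is applied to each pair of points with \<alpha> and \<beta> the values of
  e + \<epsilon>; the shift by \<epsilon> does not change the differences of e.
\<close>

lemma picone_inequality:
  assumes e: "e \<in> W0 s p \<Omega>" and e_nonneg: "AE x in lebesgue. 0 \<le> e x"
    and f: "test_function \<Omega> f" and \<epsilon>: "0 < \<epsilon>" "\<epsilon> \<le> 1"
  shows "frac_plap s p e (\<lambda>x. \<bar>f x\<bar> powr p * (max 0 (e x) + \<epsilon>) powr (1 - p)) \<le> frac_plap s p f f"
proof -
  let ?v = "\<lambda>x. \<bar>f x\<bar> powr p * (max 0 (e x) + \<epsilon>) powr (1 - p)"
  have v: "?v \<in> W0 s p \<Omega>" and f': "f \<in> W0 s p \<Omega>"
    by (rule picone_quotient_in_W0[OF e f \<epsilon>], rule test_function_in_W0[OF f])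
  have "AE z in gagliardo_measure (s * p). signed_power p (pair_diff e z) * pair_diff ?v z
      \<le> signed_power p (pair_diff f z) * pair_diff f z"
    using AE_gagliardo_measure_pair[OF e_nonneg]
  proof eventually_elim
    case (elim z)
    let ?x = "fst z" and ?y = "snd z"
    have "signed_power p ((e ?x + \<epsilon>) - (e ?y + \<epsilon>))
        * (\<bar>f ?x\<bar> powr p * (e ?x + \<epsilon>) powr (1 - p) - \<bar>f ?y\<bar> powr p * (e ?y + \<epsilon>) powr (1 - p))
        \<le> \<bar>\<bar>f ?x\<bar> - \<bar>f ?y\<bar>\<bar> powr p"
      using elim \<epsilon> p by (intro picone_discrete) auto
    also have "\<dots> \<le> \<bar>f ?x - f ?y\<bar> powr p"
      using p by (intro powr_mono2) auto
    finally show ?case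
      using elim by (simp add: signed_power_self pair_diff_def max_def)
  qed
  then show ?thesis
    using integrable_pairing[OF e v] integrable_pairing[OF f' f']
    unfolding frac_plap_eq[OF W0_measurable[OF e] W0_measurable[OF v]]
      frac_plap_eq[OF W0_measurable[OF f'] W0_measurable[OF f']]
    by (intro integral_mono_AE)
qed

lemma eigenvalue_nonneg:
  assumes "eigenfunction s p \<Omega> \<mu> e"
  shows "0 \<le> \<mu>"
proof -
  have e: "e \<in> W0 s p \<Omega>" and nonzero: "\<not> (AE x in lebesgue. e x = 0)"
    and weak: "frac_plap s p e e = \<mu> * (\<integral>x. \<bar>e x\<bar> powr (p - 2) * e x * e x \<partial>lebesgue_on \<Omega>)"
    using assms by (auto simp: eigenfunction_def)
  let ?I = "\<integral>x. \<bar>e x\<bar> powr p \<partial>lebesgue_on \<Omega>"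
  have "0 \<le> \<mu> * ?I"
    using energy_eq_pairing(2)[OF e] weak signed_power_self[of p "e x" for x]
    by (simp add: signed_power_def)
  moreover have "?I \<noteq> 0"
  proof
    assume "?I = 0"
    then have "AE x in lebesgue_on \<Omega>. \<bar>e x\<bar> powr p = 0"
      using integral_nonneg_eq_0_iff_AE[OF mass_eq_integral(1)[OF e]] by simp
    then have "AE x in lebesgue. x \<in> \<Omega> \<longrightarrow> e x = 0"
      by (subst (asm) AE_restrict_space_iff) auto
    with W0_zero_outside[OF e] have "AE x in lebesgue. e x = 0"
      by eventually_elim blast
    then show False using nonzero by contradiction
  qed
  moreover have "0 \<le> ?I" by simp
  ultimately show ?thesis
    by (metis less_eq_real_def mult_neg_pos not_less)
qed

lemma AE_nonneg_of_pos_in_domain: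
  assumes "e \<in> W0 s p \<Omega>" and "AE x in lebesgue_on \<Omega>. 0 < e x"
  shows "AE x in lebesgue. 0 \<le> e x"
proof -
  have "AE x in lebesgue. x \<in> \<Omega> \<longrightarrow> 0 < e x"
    using assms(2) by (subst (asm) AE_restrict_space_iff) auto
  with W0_zero_outside[OF assms(1)] show ?thesis
    by eventually_elim force
qed

text \<open>
  The eigenvalue equation tested with |f|^p / (e + \<epsilon>)^(p-1) has the right-hand side
  \<mu> |f|^p (e / (e + \<epsilon>))^(p-1), which tends to \<mu> |f|^p as \<epsilon> tends to 0, because e is positive.
\<close>

lemma rayleigh_test_function:
  assumes e: "eigenfunction s p \<Omega> \<mu> e" and pos: "AE x in lebesgue_on \<Omega>. 0 < e x"
    and f: "test_function \<Omega> f"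
  shows "\<mu> * (\<integral>x. \<bar>f x\<bar> powr p \<partial>lebesgue_on \<Omega>) \<le> frac_plap s p f f"
proof -
  have e_W0: "e \<in> W0 s p \<Omega>" using e by (simp add: eigenfunction_def)
  note f_W0 = test_function_in_W0[OF f]
  define \<epsilon> where "\<epsilon> n = 1 / real (Suc n)" for n
  have \<epsilon>: "0 < \<epsilon> n" "\<epsilon> n \<le> 1" for n
    by (auto simp: \<epsilon>_def)
  have \<epsilon>_lim: "\<epsilon> \<longlonglongrightarrow> 0"
    unfolding \<epsilon>_def using LIMSEQ_inverse_real_of_nat by (simp add: inverse_eq_divide)
  define v where "v n x = \<bar>f x\<bar> powr p * (max 0 (e x) + \<epsilon> n) powr (1 - p)" for n x
  have v: "v n \<in> W0 s p \<Omega>" for n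
    unfolding v_def by (rule picone_quotient_in_W0[OF e_W0 f \<epsilon>])
  have [measurable]: "u \<in> borel_measurable (lebesgue_on \<Omega>)" if "u \<in> W0 s p \<Omega>" for u
    using W0_measurable[OF that] by (rule measurable_restrict_space1)
  note [measurable] = this[OF e_W0] this[OF f_W0] this[OF v]
  let ?g = "\<lambda>n x. signed_power p (e x) * v n x"
  have "\<mu> * (\<integral>x. ?g n x \<partial>lebesgue_on \<Omega>) \<le> frac_plap s p f f" for n
  proof -
    have "\<mu> * (\<integral>x. ?g n x \<partial>lebesgue_on \<Omega>) = frac_plap s p e (v n)"
      using e v by (simp add: eigenfunction_def signed_power_def)
    also have "\<dots> \<le> frac_plap s p f f"
      unfolding v_def by (rule picone_inequality[OF e_W0 AE_nonneg_of_pos_in_domain[OF e_W0 pos] f \<epsilon>])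
    finally show ?thesis .
  qed
  moreover have "(\<lambda>n. \<integral>x. ?g n x \<partial>lebesgue_on \<Omega>) \<longlonglongrightarrow> (\<integral>x. \<bar>f x\<bar> powr p \<partial>lebesgue_on \<Omega>)"
  proof (rule integral_dominated_convergence[OF _ _ mass_eq_integral(1)[OF f_W0]])
    show "AE x in lebesgue_on \<Omega>. (\<lambda>n. ?g n x) \<longlonglongrightarrow> \<bar>f x\<bar> powr p"
      using pos
    proof eventually_elim
      case (elim x)
      have "(\<lambda>n. signed_power p (e x) * v n x) \<longlonglongrightarrow> signed_power p (e x) * (\<bar>f x\<bar> powr p * (max 0 (e x) + 0) powr (1 - p))"
        unfolding v_def using elim
        by (intro tendsto_mult tendsto_const tendsto_powr tendsto_add \<epsilon>_lim) auto
      moreover have "signed_power p (e x) * (\<bar>f x\<bar> powr p * (max 0 (e x) + 0) powr (1 - p)) = \<bar>f x\<bar> powr p"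
      proof -
        have "e x powr (p - 1) * e x powr (1 - p) = 1"
          using elim by (simp flip: powr_add)
        then show ?thesis
          using elim by (simp add: signed_power_nonneg max_def mult.left_commute)
      qed
      ultimately show ?case by (simp only:)
    qed
    show "AE x in lebesgue_on \<Omega>. norm (?g n x) \<le> \<bar>f x\<bar> powr p" for n
      using pos
    proof eventually_elim
      case (elim x)
      have "e x powr (p - 1) * (e x + \<epsilon> n) powr (1 - p) \<le> e x powr (p - 1) * e x powr (1 - p)"
        using elim p \<epsilon>(1)[of n] by (intro mult_left_mono powr_mono2') auto
      also have "\<dots> = 1"
        using elim by (simp flip: powr_add)
      finally have "\<bar>f x\<bar> powr p * (e x powr (p - 1) * (e x + \<epsilon> n) powr (1 - p)) \<le> \<bar>f x\<bar> powr p * 1"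
        by (intro mult_left_mono) auto
      then show ?case
        using elim by (simp add: v_def signed_power_nonneg max_def abs_mult mult_ac)
    qed
  qed measurable
  then have "(\<lambda>n. \<mu> * (\<integral>x. ?g n x \<partial>lebesgue_on \<Omega>)) \<longlonglongrightarrow> \<mu> * (\<integral>x. \<bar>f x\<bar> powr p \<partial>lebesgue_on \<Omega>)"
    by (rule tendsto_mult_left)
  ultimately show ?thesis
    by (intro LIMSEQ_le_const2) auto
qed

text \<open>
  The bound extends from test functions by density. With the weighted triangle inequality used for
  both sides, first the approximation error tends to 0 for fixed \<theta>, and then the remaining factor
  tends to 1 as \<theta> tends to 0.
\<close>

theorem rayleigh_quotient_bound:
  assumes e: "eigenfunction s p \<Omega> \<mu> e" and pos: "AE x in lebesgue_on \<Omega>. 0 < e x"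
    and u: "u \<in> W0 s p \<Omega>"
  shows "\<mu> * (\<integral>x. \<bar>u x\<bar> powr p \<partial>lebesgue_on \<Omega>) \<le> frac_plap s p u u"
proof -
  note \<mu> = eigenvalue_nonneg[OF e]
  obtain f where f: "approximates f u"
    using approximates_exists[OF u] .
  note [measurable] = W0_measurable[OF u] test_function_measurable[OF approximatesD(2)[OF f]]
  have test: "ennreal \<mu> * mass p (f n) \<le> energy s p (f n)" for n
    using rayleigh_test_function[OF e pos approximatesD(2)[OF f, of n]] \<mu>
      mass_eq_integral(2)[OF test_function_in_W0[OF approximatesD(2)[OF f, of n]]]
      energy_eq_pairing(1)[OF test_function_in_W0[OF approximatesD(2)[OF f, of n]]]
    by (simp add: ennreal_leI flip: ennreal_mult)
  have weighted: "ennreal \<mu> * mass p u \<le> ennreal (a * a) * energy s p u"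
    if \<theta>: "0 < \<theta>" "\<theta> < 1" and a: "a = (1 - \<theta>) powr (1 - p)" for a \<theta>
  proof -
    define b where "b = \<theta> powr (1 - p)"
    define m where "m n = mass p (\<lambda>x. u x - f n x)" for n
    define E where "E n = energy s p (\<lambda>x. u x - f n x)" for n
    have "ennreal \<mu> * mass p u \<le> ennreal a * (ennreal a * energy s p u + ennreal b * E n) + ennreal \<mu> * (ennreal b * m n)" for n
    proof -
      have diff: "pair_diff (\<lambda>x. u x - f n x) z = pair_diff u z - pair_diff (f n) z" for z
        by (simp add: pair_diff_def)
      have "mass p u \<le> ennreal a * mass p (f n) + ennreal b * m n"
        unfolding mass_def m_def a b_def using p \<theta> by (intro lp_weighted_triangle) auto
      then have "ennreal \<mu> * mass p u \<le> ennreal \<mu> * (ennreal a * mass p (f n) + ennreal b * m n)"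
        by (rule mult_left_mono) simp
      also have "\<dots> = ennreal a * (ennreal \<mu> * mass p (f n)) + ennreal \<mu> * (ennreal b * m n)"
        by (simp add: distrib_left mult_ac)
      also have "ennreal \<mu> * mass p (f n) \<le> energy s p (f n)"
        by (rule test)
      also have "energy s p (f n) \<le> ennreal a * energy s p u + ennreal b * E n"
        unfolding energy_def E_def a b_def diff using p \<theta> by (intro lp_weighted_triangle) auto
      finally show ?thesis
        by (simp add: mult_left_mono add_right_mono)
    qed
    moreover have "(\<lambda>n. ennreal a * (ennreal a * energy s p u + ennreal b * E n) + ennreal \<mu> * (ennreal b * m n))
        \<longlonglongrightarrow> ennreal a * (ennreal a * energy s p u + ennreal b * 0) + ennreal \<mu> * (ennreal b * 0)"
      using approximatesD(3,4)[OF f] unfolding E_def m_def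
      by (intro tendsto_add ennreal_tendsto_cmult tendsto_const) auto
    ultimately have "ennreal \<mu> * mass p u
        \<le> ennreal a * (ennreal a * energy s p u + ennreal b * 0) + ennreal \<mu> * (ennreal b * 0)"
      by (intro LIMSEQ_le_const) auto
    moreover have "0 \<le> a" by (simp add: a)
    ultimately show ?thesis
      by (simp add: ennreal_mult mult.assoc)
  qed
  define a where "a n = (1 - 1 / real (Suc (Suc n))) powr (1 - p)" for n
  have "\<mu> * (\<integral>x. \<bar>u x\<bar> powr p \<partial>lebesgue_on \<Omega>) \<le> a n * a n * frac_plap s p u u" for n
  proof -
    have "ennreal (\<mu> * (\<integral>x. \<bar>u x\<bar> powr p \<partial>lebesgue_on \<Omega>)) \<le> ennreal (a n * a n * frac_plap s p u u)"
      using weighted[of "1 / real (Suc (Suc n))" "a n"] \<mu>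
      by (simp add: a_def mass_eq_integral(2)[OF u] energy_eq_pairing[OF u] flip: ennreal_mult)
    moreover have "0 \<le> a n * a n * frac_plap s p u u"
      using energy_eq_pairing(2)[OF u] by (simp add: a_def)
    ultimately show ?thesis by (simp add: ennreal_le_iff)
  qed
  moreover have "(\<lambda>n. a n * a n * frac_plap s p u u) \<longlonglongrightarrow> 1 * 1 * frac_plap s p u u"
  proof -
    have "(\<lambda>n. 1 / real (Suc (Suc n))) \<longlonglongrightarrow> 0"
      using LIMSEQ_Suc[OF LIMSEQ_inverse_real_of_nat] by (simp add: inverse_eq_divide)
    then have "a \<longlonglongrightarrow> (1 - 0) powr (1 - p)"
      unfolding a_def by (intro tendsto_powr tendsto_diff tendsto_const) auto
    then show ?thesis by (intro tendsto_mult tendsto_const) auto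
  qed
  ultimately show ?thesis
    by (intro LIMSEQ_le_const[of _ "frac_plap s p u u"]) auto
qed

section \<open>Eigenfunctions and the torsion function\<close>

text \<open>
  The bound e \<le> 1 makes e a subsolution of the equation with constant right-hand side \<mu>, which the
  multiple \<mu>^(1/(p-1)) \<phi> solves by homogeneity.
\<close>

theorem eigenfunction_le_torsion_function:
  assumes e: "eigenfunction s p \<Omega> \<mu> e" and \<phi>: "torsion_function s p \<Omega> \<phi>"
    and bound: "AE x in lebesgue_on \<Omega>. 0 < e x \<and> e x \<le> 1"
  shows "AE x in lebesgue_on \<Omega>. e x \<le> \<mu> powr (1 / (p - 1)) * \<phi> x"
proof -
  note \<mu> = eigenvalue_nonneg[OF e]
  have e_W0: "e \<in> W0 s p \<Omega>" and \<phi>_W0: "\<phi> \<in> W0 s p \<Omega>"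
    using e \<phi> by (auto simp: eigenfunction_def torsion_function_def)
  define c where "c = \<mu> powr (1 / (p - 1))"
  have c: "0 \<le> c" "c powr (p - 1) = \<mu>"
    using \<mu> p by (auto simp: c_def powr_powr)
  have w: "(\<lambda>x. c * \<phi> x) \<in> W0 s p \<Omega>"
    by (rule W0_scale[OF \<phi>_W0])
  define v where "v x = max 0 (e x - c * \<phi> x)" for x
  have v: "v \<in> W0 s p \<Omega>"
    unfolding v_def by (rule W0_pos_part_diff[OF e_W0 w])
  have [measurable]: "e \<in> borel_measurable (lebesgue_on \<Omega>)" "v \<in> borel_measurable (lebesgue_on \<Omega>)"
    using W0_measurable[OF e_W0] W0_measurable[OF v] by (auto intro: measurable_restrict_space1)
  have le: "AE x in lebesgue_on \<Omega>. 0 \<le> signed_power p (e x) * v x \<and> signed_power p (e x) * v x \<le> v x"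
    using bound
  proof eventually_elim
    case (elim x)
    then have "e x powr (p - 1) \<le> 1" using p by (intro powr_le1) auto
    then show ?case
      using elim by (auto simp: signed_power_nonneg v_def intro!: mult_left_le_one_le)
  qed
  have "integrable (lebesgue_on \<Omega>) (\<lambda>x. signed_power p (e x) * v x)"
  proof (rule Bochner_Integration.integrable_bound[OF W0_integrable[OF v]])
    show "AE x in lebesgue_on \<Omega>. norm (signed_power p (e x) * v x) \<le> norm (v x)"
      using le by eventually_elim simp
  qed measurable
  then have "(\<integral>x. signed_power p (e x) * v x \<partial>lebesgue_on \<Omega>) \<le> (\<integral>x. v x \<partial>lebesgue_on \<Omega>)"
    using W0_integrable[OF v] le by (intro integral_mono_AE) auto
  then have "\<mu> * (\<integral>x. signed_power p (e x) * v x \<partial>lebesgue_on \<Omega>) \<le> \<mu> * (\<integral>x. v x \<partial>lebesgue_on \<Omega>)"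
    using \<mu> by (rule mult_left_mono)
  moreover have "frac_plap s p e v = \<mu> * (\<integral>x. signed_power p (e x) * v x \<partial>lebesgue_on \<Omega>)"
    using e v by (simp add: eigenfunction_def signed_power_def)
  moreover have "frac_plap s p (\<lambda>x. c * \<phi> x) v = \<mu> * (\<integral>x. v x \<partial>lebesgue_on \<Omega>)"
    using \<phi> v frac_plap_scale[OF c(1) W0_measurable[OF \<phi>_W0] W0_measurable[OF v]] c(2)
    by (simp add: torsion_function_def)
  ultimately have "frac_plap s p e v \<le> frac_plap s p (\<lambda>x. c * \<phi> x) v"
    by simp
  then have "AE x in lebesgue. e x \<le> c * \<phi> x"
    unfolding v_def[abs_def] by (rule comparison_principle[OF e_W0 w])
  then show ?thesis
    unfolding c_def by (subst AE_restrict_space_iff) (auto elim: eventually_mono)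
qed

text \<open>
  Let P be the integral of |\<phi>|^p and V the measure of the domain. The Rayleigh quotient
  bound and the torsion equation tested with \<phi> give \<mu> P \<le> A, and A^p \<le> V^(p-1) P by Jensen's
  inequality.
\<close>

theorem eigenvalue_le_of_torsion_function:
  assumes e: "eigenfunction s p \<Omega> \<mu> e" and pos: "AE x in lebesgue_on \<Omega>. 0 < e x"
    and \<phi>: "torsion_function s p \<Omega> \<phi>"
  defines "A \<equiv> \<integral>x. \<bar>\<phi> x\<bar> \<partial>lebesgue_on \<Omega>"
  shows "\<mu> * A powr (p - 1) \<le> measure lebesgue \<Omega> powr (p - 1)"
proof (cases "A = 0")
  case True
  then show ?thesis by simp
next
  case False
  interpret finite_measure "lebesgue_on \<Omega>"
    by (rule finite_measure_lebesgue_on[OF lmeasurable_domain])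
  note \<mu> = eigenvalue_nonneg[OF e]
  have \<phi>_W0: "\<phi> \<in> W0 s p \<Omega>"
    using \<phi> by (simp add: torsion_function_def)
  have A: "0 < A" using False by (simp add: A_def less_le)
  let ?P = "\<integral>x. \<bar>\<phi> x\<bar> powr p \<partial>lebesgue_on \<Omega>"
  let ?V = "measure lebesgue \<Omega> powr (p - 1)"
  have "\<mu> * ?P \<le> (\<integral>x. \<phi> x \<partial>lebesgue_on \<Omega>)"
    using rayleigh_quotient_bound[OF e pos \<phi>_W0] \<phi> \<phi>_W0 by (simp add: torsion_function_def)
  also have "\<dots> \<le> A"
    unfolding A_def using W0_integrable[OF \<phi>_W0] by (intro integral_mono) auto
  finally have "?V * (\<mu> * ?P) \<le> ?V * A"
    by (rule mult_left_mono) simp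
  have "A powr p \<le> ?V * ?P"
    using integral_abs_powr_le[OF p W0_integrable[OF \<phi>_W0] mass_eq_integral(1)[OF \<phi>_W0]]
    by (simp add: A_def measure_restrict_space space_restrict_space)
  then have "\<mu> * A powr p \<le> \<mu> * (?V * ?P)"
    using \<mu> by (rule mult_left_mono)
  also have "\<dots> \<le> ?V * A"
    using \<open>?V * (\<mu> * ?P) \<le> ?V * A\<close> by (simp add: mult_ac)
  also have "A powr p = A powr (p - 1) * A"
    using A by (simp add: powr_diff)
  finally show ?thesis
    using A by (simp flip: mult.assoc)
qed

end

text \<open>
  If \<phi> is essentially unbounded, the left-hand side is 1 / \<infinity> = 0. Otherwise the pointwise bound
  gives 1 \<le> \<mu>^(1/(p-1)) r with r the essential supremum.
\<close>

lemma eigenvalue_ge_of_Linf_bound: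
  fixes e \<phi> :: "'a::euclidean_space \<Rightarrow> real"
  assumes p: "1 < p" and \<mu>: "0 \<le> \<mu>" and [measurable]: "e \<in> borel_measurable (lebesgue_on \<Omega>)"
    and norm_e: "Linf_norm \<Omega> e = 1" and e_nonneg: "AE x in lebesgue_on \<Omega>. 0 \<le> e x"
    and le: "AE x in lebesgue_on \<Omega>. e x \<le> \<mu> powr (1 / (p - 1)) * \<phi> x"
  shows "1 / enn2ereal (epowr (Linf_norm \<Omega> \<phi>) (p - 1)) \<le> ereal \<mu>"
proof (cases "Linf_norm \<Omega> \<phi>")
  case (real r)
  define c where "c = \<mu> powr (1 / (p - 1))"
  have c: "0 \<le> c" "c powr (p - 1) = \<mu>"
    using \<mu> p by (auto simp: c_def powr_powr)
  have "AE x in lebesgue_on \<Omega>. ennreal \<bar>\<phi> x\<bar> \<le> ennreal r"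
    using esssup_AE[of "\<lambda>x. ennreal \<bar>\<phi> x\<bar>" "lebesgue_on \<Omega>"] real by (simp add: Linf_norm_def)
  with le e_nonneg have "AE x in lebesgue_on \<Omega>. ennreal \<bar>e x\<bar> \<le> ennreal (c * r)"
  proof eventually_elim
    case (elim x)
    have "c * \<phi> x \<le> c * r"
      using elim(3) real c by (intro mult_left_mono) auto
    then show ?case using elim by (auto simp: c_def intro!: ennreal_leI)
  qed
  then have "Linf_norm \<Omega> e \<le> ennreal (c * r)"
    unfolding Linf_norm_def by (intro esssup_I) auto
  then have "1 \<le> c * r"
    using norm_e by (simp add: ennreal_ge_1)
  then have "1 powr (p - 1) \<le> (c * r) powr (p - 1)"
    using p by (intro powr_mono2) auto
  then have le1: "1 \<le> \<mu> * r powr (p - 1)"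
    using c by (simp add: powr_mult)
  moreover have "0 < r" using \<open>1 \<le> c * r\<close> real by (cases "r = 0") auto
  ultimately show ?thesis
    using real p by (simp add: epowr_def enn2ereal_ennreal one_ereal_def divide_le_eq)
next
  case top
  then show ?thesis using \<mu> by (simp add: epowr_def)
qed

theorem corollary2p2:
  fixes \<Omega> :: "(real ^ 'n) set" and s p :: real and \<phi> e :: "real ^ 'n \<Rightarrow> real"
  assumes "CARD('n) \<ge> 2"
    and "lipschitz_bounded_domain \<Omega>"
    and "0 < s" and "s < 1" and "1 < p" and "p < real CARD('n) / s"
    and "torsion_function s p \<Omega> \<phi>"
    and "normalized_first_eigenfunction s p \<Omega> e"
  shows "(AE x in lebesgue_on \<Omega>. e x \<le> first_eigenvalue s p \<Omega> powr (1 / (p - 1)) * \<phi> x)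
    \<and> 1 / enn2ereal (epowr (Linf_norm \<Omega> \<phi>) (p - 1)) \<le> ereal (first_eigenvalue s p \<Omega>)
    \<and> ereal (first_eigenvalue s p \<Omega>)
        \<le> enn2ereal (epowr (emeasure lebesgue \<Omega>) (p - 1)) / enn2ereal (epowr (Lnorm 1 \<Omega> \<phi>) (p - 1))"
proof -
  let ?\<mu> = "first_eigenvalue s p \<Omega>"
  have dom: "open \<Omega>" "bounded \<Omega>" "\<Omega> \<noteq> {}"
    using assms(2) by (auto simp: lipschitz_bounded_domain_def)
  interpret fractional_sobolev s p \<Omega>
    using assms(3-5) dom by unfold_locales auto
  have eig: "eigenfunction s p \<Omega> ?\<mu> e" and pos: "AE x in lebesgue_on \<Omega>. 0 < e x"
    and norm_e: "Linf_norm \<Omega> e = 1"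
    using assms(8) by (auto simp: normalized_first_eigenfunction_def)
  have e_W0: "e \<in> W0 s p \<Omega>" and \<phi>_W0: "\<phi> \<in> W0 s p \<Omega>"
    using eig assms(7) by (auto simp: eigenfunction_def torsion_function_def)
  note \<mu> = eigenvalue_nonneg[OF eig]
  have "AE x in lebesgue_on \<Omega>. ennreal \<bar>e x\<bar> \<le> 1"
    using esssup_AE[of "\<lambda>x. ennreal \<bar>e x\<bar>" "lebesgue_on \<Omega>"] norm_e by (simp add: Linf_norm_def)
  with pos have bound: "AE x in lebesgue_on \<Omega>. 0 < e x \<and> e x \<le> 1"
    by eventually_elim (simp flip: ennreal_1)
  have le: "AE x in lebesgue_on \<Omega>. e x \<le> ?\<mu> powr (1 / (p - 1)) * \<phi> x"
    by (rule eigenfunction_le_torsion_function[OF eig assms(7) bound])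
  have lower: "1 / enn2ereal (epowr (Linf_norm \<Omega> \<phi>) (p - 1)) \<le> ereal ?\<mu>"
  proof (rule eigenvalue_ge_of_Linf_bound[OF p \<mu> _ norm_e _ le])
    show "e \<in> borel_measurable (lebesgue_on \<Omega>)"
      using W0_measurable[OF e_W0] by (rule measurable_restrict_space1)
    show "AE x in lebesgue_on \<Omega>. 0 \<le> e x"
      using pos by eventually_elim simp
  qed
  define A where "A = (\<integral>x. \<bar>\<phi> x\<bar> \<partial>lebesgue_on \<Omega>)"
  define V where "V = measure lebesgue \<Omega>"
  have V: "emeasure lebesgue \<Omega> = ennreal V" "0 < V"
  proof -
    show eq: "emeasure lebesgue \<Omega> = ennreal V"
      unfolding V_def by (rule emeasure_eq_ennreal_measure[OF fmeasurableD2[OF lmeasurable_domain]])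
    have "\<Omega> \<notin> null_sets lebesgue"
      using open_not_negligible[OF dom(1,3)] by (simp add: negligible_iff_null_sets)
    then have "emeasure lebesgue \<Omega> \<noteq> 0"
      using null_setsI[OF _ measurable_domain] by blast
    then have "V \<noteq> 0" unfolding eq by auto
    then show "0 < V" by (simp add: V_def less_le)
  qed
  have A: "Lnorm 1 \<Omega> \<phi> = ennreal A" "0 \<le> A"
  proof -
    have "(\<integral>\<^sup>+x. ennreal (\<bar>\<phi> x\<bar> powr 1) \<partial>lebesgue_on \<Omega>) = ennreal A"
      unfolding A_def using W0_integrable[OF \<phi>_W0] by (simp add: nn_integral_eq_integral)
    moreover show "0 \<le> A" by (simp add: A_def)
    ultimately show "Lnorm 1 \<Omega> \<phi> = ennreal A"
      by (simp add: Lnorm_def epowr_def)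
  qed
  have upper: "?\<mu> * A powr (p - 1) \<le> V powr (p - 1)"
    unfolding A_def V_def by (rule eigenvalue_le_of_torsion_function[OF eig pos assms(7)])
  have "ereal ?\<mu> \<le> ereal (V powr (p - 1)) / ereal (A powr (p - 1))"
  proof (cases "A = 0")
    case True
    then show ?thesis using V by (simp add: divide_ereal_def)
  next
    case False
    then show ?thesis
      using upper A(2) by (simp add: le_divide_eq less_le)
  qed
  then show ?thesis
    using le lower A V by (simp add: epowr_def enn2ereal_ennreal)
qed

end
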